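(* Let $K$ be a field and let $a\ge2$, $n\ge1$, $b\ge3$ be integers. Then the graph $G_{a,b,n}=\overline{K}_a\nabla(nB_b)$ is not sequentially Cohen–Macaulay.
   Context: All graphs are finite, simple and undirected. For $b\ge 2$, $B_b$ is the graph with vertices $x_1,\dots,x_b,y_1,\dots,y_b$ and edges $\{x_i,x_j\}$ and $\{y_i,y_j\}$ for $1\le i<j\le b$, and $\{x_i,y_i\}$ for $1\le i\le b$. $nB_b$ is the disjoint union of $n$ copies of $B_b$. The join $G\nabla H$ of graphs on disjoint vertex sets is obtained from the disjoint union by adding every edge between $V(G)$ and $V(H)$. $\overline{K}_a$ is the edgeless graph on $a$ vertices. For a graph $G$, $R_G$ is the standard graded polynomial ring over $K$ whose variables are the vertices of $G$, and $I(G)=(xy:\{x,y\}\in E(G))\subseteq R_G$ is the edge ideal. $G$ is sequentially Cohen–Macaulay if the graded module $M=R_G/I(G)$ is: there is a finite filtration $0=M_0\subset M_1\subset\cdots\subset M_r=M$ by graded submodules such that each $M_i/M_{i-1}$ is Cohen–Macaulay and $\dim(M_1/M_0)<\dim(M_2/M_1)<\cdots<\dim(M_r/M_{r-1})$. *)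

theory Defs
  imports "HOL-Library.Poly_Mapping" "HOL-Library.Extended_Nat" "HOL-Algebra.QuotRing" "HOL-Algebra.Module"
begin

section \<open>Finite simple graphs\<close>

record 'v ugraph =
  verts :: "'v set"
  edges :: "'v set set"

definition simple_graph :: "'v ugraph \<Rightarrow> bool" where
  "simple_graph G \<longleftrightarrow> finite (verts G) \<and>
     (\<forall>e\<in>edges G. \<exists>u v. e = {u, v} \<and> u \<noteq> v \<and> u \<in> verts G \<and> v \<in> verts G)"

definition edgeless_graph :: "nat \<Rightarrow> nat ugraph" where
  "edgeless_graph a = \<lparr>verts = {1..a}, edges = {}\<rparr>"

datatype bvertex = Xv nat | Yv nat

definition B_graph :: "nat \<Rightarrow> bvertex ugraph" where
  "B_graph b =
     \<lparr>verts = Xv ` {1..b} \<union> Yv ` {1..b},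
      edges = {{Xv i, Xv j} |i j. 1 \<le> i \<and> i < j \<and> j \<le> b}
            \<union> {{Yv i, Yv j} |i j. 1 \<le> i \<and> i < j \<and> j \<le> b}
            \<union> {{Xv i, Yv i} |i. 1 \<le> i \<and> i \<le> b}\<rparr>"

definition copies :: "nat \<Rightarrow> 'v ugraph \<Rightarrow> (nat \<times> 'v) ugraph" where
  "copies n G =
     \<lparr>verts = {1..n} \<times> verts G,
      edges = {Pair k ` e |k e. k \<in> {1..n} \<and> e \<in> edges G}\<rparr>"

definition join_graph :: "'u ugraph \<Rightarrow> 'v ugraph \<Rightarrow> ('u + 'v) ugraph"  (infixl "\<nabla>" 65) where
  "G \<nabla> H =
     \<lparr>verts = verts G <+> verts H,
      edges = (image Inl) ` edges G \<union> (image Inr) ` edges H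
            \<union> {{Inl u, Inr v} |u v. u \<in> verts G \<and> v \<in> verts H}\<rparr>"

lemma simple_graph_edgeless: "simple_graph (edgeless_graph a)"
  by (simp add: simple_graph_def edgeless_graph_def)

lemma simple_graph_B: "simple_graph (B_graph b)"
proof -
  have "finite (verts (B_graph b))"
    by (simp add: B_graph_def)
  moreover have "\<exists>u v. e = {u, v} \<and> u \<noteq> v \<and> u \<in> verts (B_graph b) \<and> v \<in> verts (B_graph b)"
    if e: "e \<in> edges (B_graph b)" for e
  proof -
    consider i j where "e = {Xv i, Xv j}" "1 \<le> i" "i < j" "j \<le> b"
      | i j where "e = {Yv i, Yv j}" "1 \<le> i" "i < j" "j \<le> b"
      | i where "e = {Xv i, Yv i}" "1 \<le> i" "i \<le> b"
      using e unfolding B_graph_def by simp blast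
    then show ?thesis
    proof cases
      case (1 i j)
      then show ?thesis
        by (intro exI[of _ "Xv i"] exI[of _ "Xv j"]) (simp add: B_graph_def)
    next
      case (2 i j)
      then show ?thesis
        by (intro exI[of _ "Yv i"] exI[of _ "Yv j"]) (simp add: B_graph_def)
    next
      case (3 i)
      then show ?thesis
        by (intro exI[of _ "Xv i"] exI[of _ "Yv i"]) (simp add: B_graph_def)
    qed
  qed
  ultimately show ?thesis
    unfolding simple_graph_def by blast
qed

lemma simple_graph_copies:
  assumes "simple_graph G" shows "simple_graph (copies n G)"
proof -
  have "\<exists>u v. e = {u, v} \<and> u \<noteq> v \<and> u \<in> verts (copies n G) \<and> v \<in> verts (copies n G)"
    if e: "e \<in> edges (copies n G)" for e
  proof -
    obtain k e' where k: "k \<in> {1..n}" "e' \<in> edges G" "e = Pair k ` e'"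
      using e by (auto simp: copies_def)
    moreover obtain u v where "e' = {u, v}" "u \<noteq> v" "u \<in> verts G" "v \<in> verts G"
      using assms k(2) unfolding simple_graph_def by blast
    ultimately show ?thesis
      by (intro exI[of _ "(k, u)"] exI[of _ "(k, v)"]) (simp add: copies_def)
  qed
  moreover have "finite (verts (copies n G))"
    using assms by (simp add: simple_graph_def copies_def)
  ultimately show ?thesis
    unfolding simple_graph_def by blast
qed

lemma simple_graph_join:
  assumes "simple_graph G" "simple_graph H" shows "simple_graph (G \<nabla> H)"
proof -
  have "\<exists>u v. e = {u, v} \<and> u \<noteq> v \<and> u \<in> verts (G \<nabla> H) \<and> v \<in> verts (G \<nabla> H)"
    if e: "e \<in> edges (G \<nabla> H)" for e
  proof -
    consider e' where "e' \<in> edges G" "e = Inl ` e'"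
      | e' where "e' \<in> edges H" "e = Inr ` e'"
      | u v where "e = {Inl u, Inr v}" "u \<in> verts G" "v \<in> verts H"
      using e by (auto simp: join_graph_def)
    then show ?thesis
    proof cases
      case (1 e')
      then obtain u v where "e' = {u, v}" "u \<noteq> v" "u \<in> verts G" "v \<in> verts G"
        using assms(1) unfolding simple_graph_def by blast
      with 1 show ?thesis
        by (intro exI[of _ "Inl u"] exI[of _ "Inl v"]) (simp add: join_graph_def InlI)
    next
      case (2 e')
      then obtain u v where "e' = {u, v}" "u \<noteq> v" "u \<in> verts H" "v \<in> verts H"
        using assms(2) unfolding simple_graph_def by blast
      with 2 show ?thesis
        by (intro exI[of _ "Inr u"] exI[of _ "Inr v"]) (simp add: join_graph_def InlI InrI)
    next
      case (3 u v)
      then show ?thesis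
        by (intro exI[of _ "Inl u"] exI[of _ "Inr v"]) (simp add: join_graph_def InlI InrI)
    qed
  qed
  moreover have "finite (verts (G \<nabla> H))"
    using assms by (simp add: simple_graph_def join_graph_def)
  ultimately show ?thesis
    unfolding simple_graph_def by blast
qed


section \<open>Modules\<close>

definition self_module :: "('a, 'c) ring_scheme \<Rightarrow> ('a, 'a) module" where
  "self_module R =
     \<lparr>carrier = carrier R, mult = mult R, one = one R, zero = zero R, add = add R,
      smult = mult R\<rparr>"

text \<open>The module \<open>M/N\<close>. The fields \<open>mult\<close> and \<open>one\<close> of a module record play no role, as
  modules are only required to be additive groups. The coset \<open>r \<odot> C\<close> is written as the union
  of the cosets of the elements \<open>r \<odot> x\<close> for \<open>x \<in> C\<close>, all of which coincide.\<close>

definition quot_module :: "('a, 'm, 'd) module_scheme \<Rightarrow> 'm set \<Rightarrow> ('a, 'm set) module" where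
  "quot_module M N =
     \<lparr>carrier = a_rcosets\<^bsub>M\<^esub> N, mult = undefined, one = undefined, zero = N,
      add = (<+>\<^bsub>M\<^esub>),
      smult = (\<lambda>r C. \<Union>x\<in>C. N +>\<^bsub>M\<^esub> (r \<odot>\<^bsub>M\<^esub> x))\<rparr>"

lemma self_module_module:
  assumes "cring R" shows "module R (self_module R)"
proof -
  interpret cring R by fact
  have "abelian_group (self_module R)"
    by (rule abelian_groupI) (auto simp: self_module_def a_ac intro: add.l_inv_ex)
  then show ?thesis
    by (intro moduleI) (auto simp: self_module_def assms l_distr r_distr m_assoc)
qed

lemma quot_module_module:
  assumes "module R M" "submodule N R M" shows "module R (quot_module M N)"
proof -
  interpret module R M by fact
  interpret N: submodule N R M by fact
  interpret N: abelian_subgroup N M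
    by (rule abelian_subgroupI3) (auto intro!: additive_subgroup.intro N.subgroup_axioms M.abelian_group_axioms)
  have NM: "N \<subseteq> carrier M" by (rule N.a_subset)
  have sm: "r \<odot>\<^bsub>quot_module M N\<^esub> (N +>\<^bsub>M\<^esub> x) = N +>\<^bsub>M\<^esub> (r \<odot>\<^bsub>M\<^esub> x)"
    if r: "r \<in> carrier R" and x: "x \<in> carrier M" for r x
  proof -
    have eq: "N +>\<^bsub>M\<^esub> (r \<odot>\<^bsub>M\<^esub> y) = N +>\<^bsub>M\<^esub> (r \<odot>\<^bsub>M\<^esub> x)" if y: "y \<in> N +>\<^bsub>M\<^esub> x" for y
    proof -
      obtain h where h: "h \<in> N" "y = h \<oplus>\<^bsub>M\<^esub> x"
        using y by (auto simp: a_r_coset_def r_coset_def)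
      then have "r \<odot>\<^bsub>M\<^esub> y = r \<odot>\<^bsub>M\<^esub> h \<oplus>\<^bsub>M\<^esub> r \<odot>\<^bsub>M\<^esub> x"
        using r x NM by (auto simp: smult_r_distr)
      then have "r \<odot>\<^bsub>M\<^esub> y \<in> N +>\<^bsub>M\<^esub> (r \<odot>\<^bsub>M\<^esub> x)"
        using r h by (auto simp: a_r_coset_def r_coset_def)
      then show ?thesis
        using M.a_repr_independence[OF _ _ N.a_subgroup] r x by (metis smult_closed)
    qed
    have "r \<odot>\<^bsub>quot_module M N\<^esub> (N +>\<^bsub>M\<^esub> x) = (\<Union>y\<in>N +>\<^bsub>M\<^esub> x. N +>\<^bsub>M\<^esub> (r \<odot>\<^bsub>M\<^esub> y))"
      by (simp add: quot_module_def)
    also have "\<dots> = (\<Union>y\<in>N +>\<^bsub>M\<^esub> x. N +>\<^bsub>M\<^esub> (r \<odot>\<^bsub>M\<^esub> x))"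
      by (rule SUP_cong[OF refl]) (rule eq)
    also have "\<dots> = N +>\<^bsub>M\<^esub> (r \<odot>\<^bsub>M\<^esub> x)"
      using N.a_rcos_self[OF x] by (simp only: UN_constant) (metis empty_iff)
    finally show ?thesis .
  qed
  have car: "carrier (quot_module M N) = (\<lambda>x. N +>\<^bsub>M\<^esub> x) ` carrier M"
    by (auto simp: quot_module_def A_RCOSETS_def RCOSETS_def a_r_coset_def)
  have ad: "(N +>\<^bsub>M\<^esub> x) \<oplus>\<^bsub>quot_module M N\<^esub> (N +>\<^bsub>M\<^esub> y) = N +>\<^bsub>M\<^esub> (x \<oplus>\<^bsub>M\<^esub> y)"
    if "x \<in> carrier M" "y \<in> carrier M" for x y
    using N.a_rcos_sum[OF that] by (simp add: quot_module_def)
  have ze: "\<zero>\<^bsub>quot_module M N\<^esub> = N +>\<^bsub>M\<^esub> \<zero>\<^bsub>M\<^esub>"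
    by (simp add: quot_module_def NM M.a_coset_add_zero)
  have ag: "abelian_group (quot_module M N)"
  proof (rule abelian_groupI)
    fix x assume "x \<in> carrier (quot_module M N)"
    then obtain x' where "x' \<in> carrier M" "x = N +>\<^bsub>M\<^esub> x'" by (auto simp: car)
    then show "\<exists>y\<in>carrier (quot_module M N). y \<oplus>\<^bsub>quot_module M N\<^esub> x = \<zero>\<^bsub>quot_module M N\<^esub>"
      by (intro bexI[of _ "N +>\<^bsub>M\<^esub> (\<ominus>\<^bsub>M\<^esub> x')"]) (auto simp: ad ze M.l_neg car)
  qed (auto simp: car ad ze M.a_ac)
  show ?thesis
    by (rule moduleI[OF is_cring ag])
      (auto simp: car sm ad smult_l_distr smult_r_distr smult_assoc1)
qed

definition annihilator :: "('a, 'c) ring_scheme \<Rightarrow> ('a, 'm, 'd) module_scheme \<Rightarrow> 'a set" where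
  "annihilator R M = {r \<in> carrier R. \<forall>x\<in>carrier M. r \<odot>\<^bsub>M\<^esub> x = \<zero>\<^bsub>M\<^esub>}"

text \<open>Supremum of the lengths of chains of prime ideals. The zero ring, which has no prime ideals,
  gets the value 0 here; below, dimensions are only taken of nonzero modules.\<close>

definition krull_dim :: "('a, 'c) ring_scheme \<Rightarrow> enat" where
  "krull_dim A =
     (SUP n \<in> {n. \<exists>P :: nat \<Rightarrow> 'a set.
                    (\<forall>i\<le>n. primeideal (P i) A) \<and> (\<forall>i<n. P i \<subset> P (Suc i))}. enat n)"

definition module_dim :: "('a, 'c) ring_scheme \<Rightarrow> ('a, 'm, 'd) module_scheme \<Rightarrow> enat" where
  "module_dim R M = krull_dim (R Quot annihilator R M)"

text \<open>The submodule \<open>(x\<^sub>1, \<dots>, x\<^sub>k) M\<close>.\<close>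

definition seq_times :: "'a list \<Rightarrow> ('a, 'm, 'd) module_scheme \<Rightarrow> 'm set" where
  "seq_times xs M =
     {\<Oplus>\<^bsub>M\<^esub>j\<in>{..<length xs}. (xs ! j) \<odot>\<^bsub>M\<^esub> y j |y. y \<in> {..<length xs} \<rightarrow> carrier M}"

definition nonzerodivisor_on :: "'a \<Rightarrow> ('a, 'm, 'd) module_scheme \<Rightarrow> bool" where
  "nonzerodivisor_on x M \<longleftrightarrow> (\<forall>y\<in>carrier M. x \<odot>\<^bsub>M\<^esub> y = \<zero>\<^bsub>M\<^esub> \<longrightarrow> y = \<zero>\<^bsub>M\<^esub>)"

definition regular_sequence :: "'a list \<Rightarrow> ('a, 'm, 'd) module_scheme \<Rightarrow> bool" where
  "regular_sequence xs M \<longleftrightarrow>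
     (\<forall>i<length xs. nonzerodivisor_on (xs ! i) (quot_module M (seq_times (take i xs) M))) \<and>
     seq_times xs M \<noteq> carrier M"

text \<open>For a nonzero finitely generated graded module over a standard graded polynomial ring, depth
  is the maximal length of a regular sequence in the graded maximal ideal \<open>\<mm>\<close>, and the module is
  Cohen-Macaulay if its depth equals its dimension.\<close>

definition module_depth :: "'a set \<Rightarrow> ('a, 'm, 'd) module_scheme \<Rightarrow> enat" where
  "module_depth \<mm> M = (SUP xs \<in> {xs. set xs \<subseteq> \<mm> \<and> regular_sequence xs M}. enat (length xs))"

definition Cohen_Macaulay ::
    "('a, 'c) ring_scheme \<Rightarrow> 'a set \<Rightarrow> ('a, 'm, 'd) module_scheme \<Rightarrow> bool" where
  "Cohen_Macaulay R \<mm> M \<longleftrightarrow> module_depth \<mm> M = module_dim R M"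

text \<open>The grading is given by the family of its homogeneous components \<open>\<Gamma> d\<close>.\<close>

definition graded_submodule ::
    "('a, 'c) ring_scheme \<Rightarrow> (nat \<Rightarrow> 'm set) \<Rightarrow> ('a, 'm, 'd) module_scheme \<Rightarrow> 'm set \<Rightarrow> bool" where
  "graded_submodule R \<Gamma> M N \<longleftrightarrow> submodule N R M \<and>
     (\<forall>x\<in>N. \<exists>D f. (\<forall>d\<le>D. f d \<in> N \<inter> \<Gamma> d) \<and> x = (\<Oplus>\<^bsub>M\<^esub>d\<in>{..D}. f d))"

definition sequentially_Cohen_Macaulay ::
    "('a, 'c) ring_scheme \<Rightarrow> 'a set \<Rightarrow> (nat \<Rightarrow> 'm set) \<Rightarrow> ('a, 'm, 'd) module_scheme \<Rightarrow> bool" where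
  "sequentially_Cohen_Macaulay R \<mm> \<Gamma> M \<longleftrightarrow>
     (\<exists>(r :: nat) (F :: nat \<Rightarrow> 'm set).
        F 0 = {\<zero>\<^bsub>M\<^esub>} \<and> F r = carrier M \<and>
        (\<forall>i\<le>r. graded_submodule R \<Gamma> M (F i)) \<and>
        (\<forall>i<r. F i \<subset> F (Suc i)) \<and>
        (\<forall>i<r. Cohen_Macaulay R \<mm> (quot_module (M\<lparr>carrier := F (Suc i)\<rparr>) (F i))) \<and>
        (\<forall>i. Suc i < r \<longrightarrow>
           module_dim R (quot_module (M\<lparr>carrier := F (Suc i)\<rparr>) (F i))
           < module_dim R (quot_module (M\<lparr>carrier := F (Suc (Suc i))\<rparr>) (F (Suc i)))))"


section \<open>Edge ideals\<close>

text \<open>Monomials are finitely supported exponent functions; polynomials are finitely supported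
  coefficient functions on monomials, multiplied by convolution.\<close>

type_synonym ('v, 'k) mpolynomial = "('v \<Rightarrow>\<^sub>0 nat) \<Rightarrow>\<^sub>0 'k"

definition poly_ring :: "'v set \<Rightarrow> ('v, 'k::field) mpolynomial ring" where
  "poly_ring V =
     \<lparr>carrier = {p. \<forall>t\<in>Poly_Mapping.keys p. Poly_Mapping.keys t \<subseteq> V},
      mult = (*), one = 1, zero = 0, add = (+)\<rparr>"

lemma poly_ring_cring: "cring (poly_ring V :: ('v, 'k::field) mpolynomial ring)"
proof (rule cringI)
  let ?R = "poly_ring V :: ('v, 'k) mpolynomial ring"
  show "abelian_group ?R"
  proof (rule abelian_groupI)
    fix x y assume "x \<in> carrier ?R" "y \<in> carrier ?R"
    then show "x \<oplus>\<^bsub>?R\<^esub> y \<in> carrier ?R"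
      using Poly_Mapping.keys_add[of x y] by (auto simp: poly_ring_def)
  next
    fix x assume "x \<in> carrier ?R"
    then show "\<exists>y\<in>carrier ?R. y \<oplus>\<^bsub>?R\<^esub> x = \<zero>\<^bsub>?R\<^esub>"
      by (intro bexI[of _ "- x"]) (auto simp: poly_ring_def in_keys_iff)
  qed (auto simp: poly_ring_def add.assoc add.commute)
  show "comm_monoid ?R"
  proof (rule comm_monoidI)
    fix x y assume xy: "x \<in> carrier ?R" "y \<in> carrier ?R"
    have "Poly_Mapping.keys u \<subseteq> V" if u: "u \<in> Poly_Mapping.keys (x * y)" for u
    proof -
      obtain s t where st: "s \<in> Poly_Mapping.keys x" "t \<in> Poly_Mapping.keys y" "u = s + t"
        using keys_mult[of x y] u by blast
      then have "Poly_Mapping.keys s \<subseteq> V" "Poly_Mapping.keys t \<subseteq> V"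
        using xy by (simp_all add: poly_ring_def)
      then show ?thesis
        using Poly_Mapping.keys_add[of s t] st(3) by blast
    qed
    then show "x \<otimes>\<^bsub>?R\<^esub> y \<in> carrier ?R"
      by (simp add: poly_ring_def)
  qed (auto simp: poly_ring_def mult.assoc mult.commute)
qed (simp add: poly_ring_def distrib_right)

definition var :: "'v \<Rightarrow> ('v, 'k::field) mpolynomial" where
  "var v = Poly_Mapping.single (Poly_Mapping.single v 1) 1"

definition monomial_degree :: "('v \<Rightarrow>\<^sub>0 nat) \<Rightarrow> nat" where
  "monomial_degree t = (\<Sum>v\<in>Poly_Mapping.keys t. Poly_Mapping.lookup t v)"

definition homogeneous_polys :: "'v set \<Rightarrow> nat \<Rightarrow> ('v, 'k::field) mpolynomial set" where
  "homogeneous_polys V d =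
     {p \<in> carrier (poly_ring V). \<forall>t\<in>Poly_Mapping.keys p. monomial_degree t = d}"

definition irrelevant_ideal :: "'v set \<Rightarrow> ('v, 'k::field) mpolynomial set" where
  "irrelevant_ideal V = Idl\<^bsub>poly_ring V\<^esub> (var ` V)"

definition edge_ideal :: "'v ugraph \<Rightarrow> ('v, 'k::field) mpolynomial set" where
  "edge_ideal G = Idl\<^bsub>poly_ring (verts G)\<^esub> {var x * var y |x y. {x, y} \<in> edges G}"

definition edge_module ::
    "'v ugraph \<Rightarrow> (('v, 'k::field) mpolynomial, ('v, 'k) mpolynomial set) module" where
  "edge_module G = quot_module (self_module (poly_ring (verts G))) (edge_ideal G)"

definition edge_module_grading :: "'v ugraph \<Rightarrow> nat \<Rightarrow> ('v, 'k::field) mpolynomial set set" where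
  "edge_module_grading G d =
     (\<lambda>p. edge_ideal G +>\<^bsub>poly_ring (verts G)\<^esub> p) ` homogeneous_polys (verts G) d"

text \<open>The first argument selects the coefficient field, as a type.\<close>

definition sequentially_CM_graph :: "'k::field itself \<Rightarrow> 'v ugraph \<Rightarrow> bool" where
  "sequentially_CM_graph (_ :: 'k itself) G \<longleftrightarrow>
     sequentially_Cohen_Macaulay
       (poly_ring (verts G) :: ('v, 'k) mpolynomial ring)
       (irrelevant_ideal (verts G))
       (edge_module_grading G)
       (edge_module G)"

end

theory Submission
  imports Defs
begin

text \<open>Write \<open>R/I\<close> for the Stanley-Reisner ring of a join of two graphs, so that its independence
  complex is disconnected. If \<open>R/I\<close> were sequentially Cohen-Macaulay, all factors of the filtration
  would have dimension, hence depth, at least 2: the first step is a nonzero submodule of the reduced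
  ring \<open>R/I\<close>, all of whose minimal primes belong to facets with at least two vertices, and the
  dimensions increase. Depth at least 2 forces the first Koszul cohomology with respect to the
  variables to vanish, and this vanishing is inherited by extensions, hence by \<open>R/I\<close>. But the two
  components of the complex give a nontrivial class in that cohomology.\<close>


section \<open>Quotient modules\<close>

text \<open>A small depth of \<open>R/I\<close> alone is compatible with being sequentially
  Cohen-Macaulay, because factors of different dimensions are allowed. The filtration must therefore
  carry a property that ignores dimensions yet passes from factors to \<open>R/I\<close>. Vanishing
  of one fixed cohomology module is such a property, and degree one is where disconnectedness shows.
  In this degree Koszul cohomology is elementary: families \<open>z\<close> over the variables with
  \<open>s z_t = t z_s\<close>, modulo the families \<open>s y\<close>. The obstacle is that a
  regular sequence consists of arbitrary elements of the irrelevant ideal, whereas cocycles live on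
  variables. The bridge is that this ideal annihilates the cohomology, so a cocycle acquires values
  at the elements of the sequence. The bound 2 cannot be lowered: a facet with one vertex would
  allow a factor such as \<open>K[x]\<close>, where the family with value 1 at \<open>x\<close> and
  0 at the other variables is a cocycle but not a coboundary. Such facets are excluded by
  \<open>a \<ge> 2\<close> on one side of the join, and on the other by the nonadjacent pairs
  \<open>x_i\<close>, \<open>y_j\<close> with different indices in one copy.\<close>

lemma submodule_abelian_subgroup:
  assumes "module R M" "submodule N R M"
  shows "abelian_subgroup N M"
proof -
  interpret module R M by fact
  interpret N: submodule N R M by fact
  show ?thesis
    by (rule abelian_subgroupI3) (auto intro!: additive_subgroup.intro N.subgroup_axioms M.abelian_group_axioms)
qed

lemma carrier_quot_module: "carrier (quot_module M N) = (\<lambda>x. N +>\<^bsub>M\<^esub> x) ` carrier M"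
  by (auto simp: quot_module_def A_RCOSETS_def RCOSETS_def a_r_coset_def)

lemma zero_quot_module [simp]: "\<zero>\<^bsub>quot_module M N\<^esub> = N"
  by (simp add: quot_module_def)

context
  fixes R (structure) and M (structure) and N
  assumes mod: "module R M" and sub: "submodule N R M"
begin

interpretation module R M by (rule mod)
interpretation N: submodule N R M by (rule sub)
interpretation N: abelian_subgroup N M by (rule submodule_abelian_subgroup[OF mod sub])

lemma quot_module_coset_eq_iff:
  assumes "x \<in> carrier M" "y \<in> carrier M"
  shows "N +>\<^bsub>M\<^esub> x = N +>\<^bsub>M\<^esub> y \<longleftrightarrow> x \<ominus>\<^bsub>M\<^esub> y \<in> N"
proof
  assume "N +>\<^bsub>M\<^esub> x = N +>\<^bsub>M\<^esub> y"
  then have "x \<in> N +>\<^bsub>M\<^esub> y"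
    using N.a_rcos_self[OF assms(1)] by simp
  then show "x \<ominus>\<^bsub>M\<^esub> y \<in> N"
    using assms N.a_rcos_module by (simp add: a_minus_def)
next
  assume "x \<ominus>\<^bsub>M\<^esub> y \<in> N"
  then have "x \<in> N +>\<^bsub>M\<^esub> y"
    using assms N.a_rcos_module by (simp add: a_minus_def)
  then show "N +>\<^bsub>M\<^esub> x = N +>\<^bsub>M\<^esub> y"
    using M.a_repr_independence[OF _ assms(2) N.a_subgroup] by simp
qed

lemma quot_module_coset_zero_iff:
  assumes "x \<in> carrier M"
  shows "N +>\<^bsub>M\<^esub> x = N \<longleftrightarrow> x \<in> N"
  using N.a_rcos_const N.a_rcos_self[OF assms] by auto

text \<open>The union in \<open>quot_module\<close> collapses: moving \<open>y\<close> within its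
  coset changes its multiple by \<open>r\<close> only by an element of \<open>N\<close>.\<close>

lemma quot_module_smult:
  assumes r: "r \<in> carrier R" and x: "x \<in> carrier M"
  shows "r \<odot>\<^bsub>quot_module M N\<^esub> (N +>\<^bsub>M\<^esub> x) = N +>\<^bsub>M\<^esub> (r \<odot>\<^bsub>M\<^esub> x)"
proof -
  have eq: "N +>\<^bsub>M\<^esub> (r \<odot>\<^bsub>M\<^esub> y) = N +>\<^bsub>M\<^esub> (r \<odot>\<^bsub>M\<^esub> x)" if y: "y \<in> N +>\<^bsub>M\<^esub> x" for y
  proof -
    have yM: "y \<in> carrier M"
      using y x N.a_subset M.a_r_coset_subset_G by blast
    have "y \<ominus>\<^bsub>M\<^esub> x \<in> N"
      using y x yM N.a_rcos_module by (simp add: a_minus_def)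
    then have "r \<odot>\<^bsub>M\<^esub> (y \<ominus>\<^bsub>M\<^esub> x) \<in> N"
      using r by simp
    then have "r \<odot>\<^bsub>M\<^esub> y \<ominus>\<^bsub>M\<^esub> r \<odot>\<^bsub>M\<^esub> x \<in> N"
      using r x yM by (simp add: a_minus_def smult_r_distr smult_r_minus)
    then show ?thesis
      using r x yM by (simp add: quot_module_coset_eq_iff)
  qed
  have "r \<odot>\<^bsub>quot_module M N\<^esub> (N +>\<^bsub>M\<^esub> x) = (\<Union>y\<in>N +>\<^bsub>M\<^esub> x. N +>\<^bsub>M\<^esub> (r \<odot>\<^bsub>M\<^esub> y))"
    by (simp add: quot_module_def)
  also have "\<dots> = (\<Union>y\<in>N +>\<^bsub>M\<^esub> x. N +>\<^bsub>M\<^esub> (r \<odot>\<^bsub>M\<^esub> x))"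
    by (rule SUP_cong[OF refl]) (rule eq)
  also have "\<dots> = N +>\<^bsub>M\<^esub> (r \<odot>\<^bsub>M\<^esub> x)"
    using N.a_rcos_self[OF x] by (simp only: UN_constant) (metis empty_iff)
  finally show ?thesis .
qed

lemma nonzerodivisor_on_quot_module_iff:
  assumes "r \<in> carrier R"
  shows "nonzerodivisor_on r (quot_module M N) \<longleftrightarrow>
    (\<forall>x\<in>carrier M. r \<odot>\<^bsub>M\<^esub> x \<in> N \<longrightarrow> x \<in> N)"
  using assms by (auto simp: nonzerodivisor_on_def carrier_quot_module quot_module_smult quot_module_coset_zero_iff)

lemma annihilator_quot_module:
  "annihilator R (quot_module M N) = {r \<in> carrier R. \<forall>x\<in>carrier M. r \<odot>\<^bsub>M\<^esub> x \<in> N}"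
  unfolding annihilator_def
  by (rule Collect_cong) (simp add: carrier_quot_module quot_module_smult quot_module_coset_zero_iff cong: conj_cong)

end

lemma (in module) zero_submodule: "submodule {\<zero>\<^bsub>M\<^esub>} R M"
  by (rule submoduleI) auto

lemma (in module) smult_image_submodule:
  assumes r: "r \<in> carrier R"
  shows "submodule ((\<odot>\<^bsub>M\<^esub>) r ` carrier M) R M"
proof (rule submoduleI)
  show "(\<odot>\<^bsub>M\<^esub>) r ` carrier M \<subseteq> carrier M"
    using r by auto
  show "\<zero>\<^bsub>M\<^esub> \<in> (\<odot>\<^bsub>M\<^esub>) r ` carrier M"
    using r by (intro image_eqI[of _ _ "\<zero>\<^bsub>M\<^esub>"]) auto
  show "\<ominus>\<^bsub>M\<^esub> x \<in> (\<odot>\<^bsub>M\<^esub>) r ` carrier M" if "x \<in> (\<odot>\<^bsub>M\<^esub>) r ` carrier M" for x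
    using that r by (auto simp: smult_r_minus[symmetric])
  show "x \<oplus>\<^bsub>M\<^esub> y \<in> (\<odot>\<^bsub>M\<^esub>) r ` carrier M"
    if "x \<in> (\<odot>\<^bsub>M\<^esub>) r ` carrier M" "y \<in> (\<odot>\<^bsub>M\<^esub>) r ` carrier M" for x y
    using that r by (auto simp: smult_r_distr[symmetric])
  show "c \<odot>\<^bsub>M\<^esub> x \<in> (\<odot>\<^bsub>M\<^esub>) r ` carrier M"
    if c: "c \<in> carrier R" and x: "x \<in> (\<odot>\<^bsub>M\<^esub>) r ` carrier M" for c x
  proof -
    obtain y where y: "y \<in> carrier M" "x = r \<odot>\<^bsub>M\<^esub> y" using x by auto
    then have "c \<odot>\<^bsub>M\<^esub> x = r \<odot>\<^bsub>M\<^esub> (c \<odot>\<^bsub>M\<^esub> y)"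
      using r c by (simp add: smult_assoc1[symmetric] R.m_comm)
    then show ?thesis using c y by auto
  qed
qed

lemma (in module) annihilator_ideal: "ideal (annihilator R M) R"
proof (rule idealI)
  show "ring R" by (rule R.ring_axioms)
  show "subgroup (annihilator R M) (add_monoid R)"
    by (rule R.add.subgroupI)
      (auto simp: annihilator_def smult_l_distr smult_l_minus simp flip: a_inv_def intro!: exI[of _ \<zero>])
qed (auto simp: annihilator_def smult_assoc1 R.m_comm)

lemma (in module) submodule_restrict:
  assumes "submodule N R M" "submodule N' R M" "N \<subseteq> N'"
  shows "submodule N R (M\<lparr>carrier := N'\<rparr>)"
proof -
  interpret N': module R "M\<lparr>carrier := N'\<rparr>"
    using assms(2) submodule.submodule_is_module module_axioms by blast
  have "module R (M\<lparr>carrier := N\<rparr>)"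
    using assms(1) submodule.submodule_is_module module_axioms by blast
  then show ?thesis
    using assms(3) by (intro N'.module_incl_imp_submodule) auto
qed


section \<open>Vanishing of the first Koszul cohomology\<close>

text \<open>Exactness in degree one of the Koszul complex \<open>M -> M^S -> M^(S x S)\<close>: the
  equations on \<open>z\<close> are the cocycle condition, and \<open>s y\<close> is the coboundary
  of \<open>y\<close>. Indexing by the ring elements themselves avoids ordering the
  variables.\<close>

definition Koszul_H1_vanishes :: "'a set \<Rightarrow> ('a, 'm, 'd) module_scheme \<Rightarrow> bool" where
  "Koszul_H1_vanishes S M \<longleftrightarrow>
     (\<forall>z \<in> S \<rightarrow> carrier M. (\<forall>s\<in>S. \<forall>t\<in>S. s \<odot>\<^bsub>M\<^esub> z t = t \<odot>\<^bsub>M\<^esub> z s) \<longrightarrow>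
        (\<exists>y\<in>carrier M. \<forall>s\<in>S. s \<odot>\<^bsub>M\<^esub> y = z s))"

lemma (in module) Koszul_H1_vanishes_trivial:
  assumes "S \<subseteq> carrier R" "carrier M = {\<zero>\<^bsub>M\<^esub>}"
  shows "Koszul_H1_vanishes S M"
  using assms smult_r_null by (auto simp: Koszul_H1_vanishes_def Pi_iff subset_iff)

text \<open>This is exactness of \<open>H^1(N) -> H^1(M) -> H^1(M/N)\<close> at the middle term, by
  hand: a primitive \<open>y\<close> modulo \<open>N\<close> is lifted, and subtracting its
  coboundary leaves a cocycle with values in \<open>N\<close>.\<close>

lemma (in module) Koszul_H1_vanishes_extension:
  assumes sub: "submodule N R M" and S: "S \<subseteq> carrier R"
    and N: "Koszul_H1_vanishes S (M\<lparr>carrier := N\<rparr>)"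
    and Q: "Koszul_H1_vanishes S (quot_module M N)"
  shows "Koszul_H1_vanishes S M"
  unfolding Koszul_H1_vanishes_def
proof (intro ballI impI)
  fix z assume z: "z \<in> S \<rightarrow> carrier M" and co: "\<forall>s\<in>S. \<forall>t\<in>S. s \<odot>\<^bsub>M\<^esub> z t = t \<odot>\<^bsub>M\<^esub> z s"
  note [simp] = quot_module_smult[OF module_axioms sub]
  have zc: "s \<in> carrier R" "z s \<in> carrier M" if "s \<in> S" for s
    using that z S by auto
  have "\<exists>Y\<in>carrier (quot_module M N). \<forall>s\<in>S. s \<odot>\<^bsub>quot_module M N\<^esub> Y = N +>\<^bsub>M\<^esub> z s"
    using Q[unfolded Koszul_H1_vanishes_def, rule_format, of "\<lambda>s. N +>\<^bsub>M\<^esub> z s"] co zc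
    by (auto simp: carrier_quot_module)
  then obtain y where y: "y \<in> carrier M" "\<And>s. s \<in> S \<Longrightarrow> N +>\<^bsub>M\<^esub> z s = N +>\<^bsub>M\<^esub> (s \<odot>\<^bsub>M\<^esub> y)"
    using zc by (auto simp: carrier_quot_module)
  define z' where "z' s = z s \<ominus>\<^bsub>M\<^esub> s \<odot>\<^bsub>M\<^esub> y" for s
  have z': "z' s \<in> N" if "s \<in> S" for s
    using y zc[OF that] that quot_module_coset_eq_iff[OF module_axioms sub] unfolding z'_def by blast
  moreover have "s \<odot>\<^bsub>M\<^esub> z' t = t \<odot>\<^bsub>M\<^esub> z' s" if st: "s \<in> S" "t \<in> S" for s t
  proof -
    have "s \<odot>\<^bsub>M\<^esub> (t \<odot>\<^bsub>M\<^esub> y) = t \<odot>\<^bsub>M\<^esub> (s \<odot>\<^bsub>M\<^esub> y)"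
      using zc st y by (simp add: smult_assoc1[symmetric] R.m_comm)
    then show ?thesis
      using co st zc y by (simp add: z'_def a_minus_def smult_r_distr smult_r_minus)
  qed
  ultimately obtain y' where y': "y' \<in> N" "\<And>s. s \<in> S \<Longrightarrow> s \<odot>\<^bsub>M\<^esub> y' = z' s"
    using N[unfolded Koszul_H1_vanishes_def, rule_format, of z'] by auto
  have y'M: "y' \<in> carrier M"
    using y'(1) submoduleE(1)[OF sub] by auto
  have "s \<odot>\<^bsub>M\<^esub> (y' \<oplus>\<^bsub>M\<^esub> y) = z s" if "s \<in> S" for s
    using y' y'M y zc[OF that] that
    by (simp add: smult_r_distr z'_def a_minus_def M.a_assoc M.l_neg)
  then show "\<exists>y\<in>carrier M. \<forall>s\<in>S. s \<odot>\<^bsub>M\<^esub> y = z s"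
    using y'M y(1) by blast
qed

text \<open>The ideal generated by \<open>S\<close> annihilates the cohomology: the \<open>f\<close>
  for which \<open>f z\<close> is a coboundary form an ideal, and it contains each \<open>s\<close>
  in \<open>S\<close> with primitive \<open>z s\<close>. The element \<open>y\<close> acts as the
  value of \<open>z\<close> at \<open>f\<close>. Allowing \<open>T\<close> larger than
  \<open>S\<close> makes this value compatible with values adjoined earlier.\<close>

lemma (in module) cocycle_extend_to_ideal:
  assumes T: "S \<subseteq> T" "T \<subseteq> carrier R" and z: "z \<in> T \<rightarrow> carrier M"
    and co: "\<And>s t. s \<in> S \<Longrightarrow> t \<in> T \<Longrightarrow> s \<odot>\<^bsub>M\<^esub> z t = t \<odot>\<^bsub>M\<^esub> z s"
    and f: "f \<in> Idl S"
  obtains y where "y \<in> carrier M" "\<And>t. t \<in> T \<Longrightarrow> t \<odot>\<^bsub>M\<^esub> y = f \<odot>\<^bsub>M\<^esub> z t"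
proof -
  define W where "W = {f \<in> carrier R. \<exists>y\<in>carrier M. \<forall>t\<in>T. t \<odot>\<^bsub>M\<^esub> y = f \<odot>\<^bsub>M\<^esub> z t}"
  have zc: "t \<in> carrier R" "z t \<in> carrier M" if "t \<in> T" for t
    using that T z by auto
  have smW: "c \<otimes> f \<in> W" if f: "f \<in> W" and c: "c \<in> carrier R" for c f
  proof -
    obtain y where y: "y \<in> carrier M" "\<forall>t\<in>T. t \<odot>\<^bsub>M\<^esub> y = f \<odot>\<^bsub>M\<^esub> z t" "f \<in> carrier R"
      using f by (auto simp: W_def)
    have "t \<odot>\<^bsub>M\<^esub> (c \<odot>\<^bsub>M\<^esub> y) = (c \<otimes> f) \<odot>\<^bsub>M\<^esub> z t" if "t \<in> T" for t
    proof -
      have "t \<odot>\<^bsub>M\<^esub> (c \<odot>\<^bsub>M\<^esub> y) = c \<odot>\<^bsub>M\<^esub> (t \<odot>\<^bsub>M\<^esub> y)"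
        using zc[OF that] c y by (simp add: smult_assoc1[symmetric] R.m_comm)
      then show ?thesis using zc[OF that] that c y by (simp add: smult_assoc1)
    qed
    then show ?thesis
      using c y by (auto simp: W_def intro!: bexI[of _ "c \<odot>\<^bsub>M\<^esub> y"])
  qed
  have "ideal W R"
  proof (rule idealI)
    show "ring R" by (rule R.ring_axioms)
    show "subgroup W (add_monoid R)"
    proof (rule R.add.subgroupI)
      show "W \<subseteq> carrier R" by (auto simp: W_def)
      have "\<zero> \<in> W"
        using zc by (auto simp: W_def intro!: bexI[of _ "\<zero>\<^bsub>M\<^esub>"])
      then show "W \<noteq> {}" by blast
    next
      fix f assume f: "f \<in> W"
      then have "(\<ominus> \<one>) \<otimes> f \<in> W" by (intro smW) auto
      then show "\<ominus> f \<in> W"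
        using f by (simp add: W_def R.l_minus)
    next
      fix f g assume "f \<in> W" "g \<in> W"
      then obtain y y' where "y \<in> carrier M" "\<forall>t\<in>T. t \<odot>\<^bsub>M\<^esub> y = f \<odot>\<^bsub>M\<^esub> z t" "f \<in> carrier R"
        "y' \<in> carrier M" "\<forall>t\<in>T. t \<odot>\<^bsub>M\<^esub> y' = g \<odot>\<^bsub>M\<^esub> z t" "g \<in> carrier R"
        by (auto simp: W_def)
      then show "f \<oplus> g \<in> W"
        using zc by (auto simp: W_def smult_l_distr smult_r_distr intro!: bexI[of _ "y \<oplus>\<^bsub>M\<^esub> y'"])
    qed
  next
    show smW': "c \<otimes> f \<in> W" if "f \<in> W" "c \<in> carrier R" for c f
      by (rule smW[OF that])
    show "f \<otimes> c \<in> W" if "f \<in> W" "c \<in> carrier R" for c f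
      using smW[OF that] that by (simp add: W_def R.m_comm)
  qed
  moreover have "S \<subseteq> W"
  proof
    fix s assume "s \<in> S"
    then show "s \<in> W"
      using T zc co by (auto simp: W_def intro!: bexI[of _ "z s"])
  qed
  ultimately have "f \<in> W"
    using f R.genideal_minimal by blast
  then show thesis
    using that by (auto simp: W_def)
qed

section \<open>Regular sequences of length at least two\<close>

lemma (in module) seq_times_Nil: "seq_times [] M = {\<zero>\<^bsub>M\<^esub>}"
  by (simp add: seq_times_def)

lemma (in module) seq_times_singleton:
  assumes "f \<in> carrier R"
  shows "seq_times [f] M = (\<odot>\<^bsub>M\<^esub>) f ` carrier M"
proof -
  have *: "(\<Oplus>\<^bsub>M\<^esub>j\<in>{..<Suc 0}. ([f] ! j) \<odot>\<^bsub>M\<^esub> y j) = f \<odot>\<^bsub>M\<^esub> y 0" if "y 0 \<in> carrier M" for y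
    using that assms M.finsum_insert[of "{}" 0 "\<lambda>j. ([f] ! j) \<odot>\<^bsub>M\<^esub> y j"] by (simp add: lessThan_Suc)
  show ?thesis
  proof (intro equalityI subsetI)
    fix x assume "x \<in> seq_times [f] M"
    then show "x \<in> (\<odot>\<^bsub>M\<^esub>) f ` carrier M"
      by (auto simp: seq_times_def Pi_iff *)
  next
    fix x assume "x \<in> (\<odot>\<^bsub>M\<^esub>) f ` carrier M"
    then obtain y where y: "y \<in> carrier M" "x = f \<odot>\<^bsub>M\<^esub> y" by auto
    then show "x \<in> seq_times [f] M"
      using *[of "\<lambda>_. y"] unfolding seq_times_def by (auto intro!: exI[of _ "\<lambda>_. y"])
  qed
qed

text \<open>Let \<open>f\<close>, \<open>g\<close> be the first two elements. Values
  \<open>zg\<close> and \<open>zf\<close> of the cocycle at them satisfy \<open>g zf = f zg\<close>.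
  Regularity of \<open>g\<close> modulo \<open>f\<close> gives \<open>zf = f y\<close>, and then
  regularity of \<open>f\<close> gives \<open>s y = z s\<close>.\<close>

lemma (in module) Koszul_H1_vanishes_if_regular_pair:
  assumes S: "S \<subseteq> carrier R" and reg: "regular_sequence xs M"
    and xs: "set xs \<subseteq> Idl S" and len: "length xs \<ge> 2"
  shows "Koszul_H1_vanishes S M"
  unfolding Koszul_H1_vanishes_def
proof (intro ballI impI)
  fix z assume z: "z \<in> S \<rightarrow> carrier M" and co: "\<forall>s\<in>S. \<forall>t\<in>S. s \<odot>\<^bsub>M\<^esub> z t = t \<odot>\<^bsub>M\<^esub> z s"
  obtain f g ys where fg: "xs = f # g # ys"
    using len by (cases xs; cases "tl xs") auto
  have fgI: "f \<in> Idl S" "g \<in> Idl S"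
    using xs fg by auto
  then have fgR: "f \<in> carrier R" "g \<in> carrier R"
    by (simp_all add: ideal.Icarr[OF R.genideal_ideal[OF S]])
  have f_reg: "x = \<zero>\<^bsub>M\<^esub>" if "x \<in> carrier M" "f \<odot>\<^bsub>M\<^esub> x = \<zero>\<^bsub>M\<^esub>" for x
    using reg that fgR nonzerodivisor_on_quot_module_iff[OF module_axioms zero_submodule, of f]
    by (force simp: regular_sequence_def fg seq_times_Nil dest: spec[of _ 0])
  have g_reg: "\<exists>y\<in>carrier M. x = f \<odot>\<^bsub>M\<^esub> y"
    if "x \<in> carrier M" "y \<in> carrier M" "g \<odot>\<^bsub>M\<^esub> x = f \<odot>\<^bsub>M\<^esub> y" for x y
  proof -
    have "nonzerodivisor_on g (quot_module M ((\<odot>\<^bsub>M\<^esub>) f ` carrier M))"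
      using reg fgR unfolding regular_sequence_def
      by (auto simp: fg seq_times_singleton dest: spec[of _ "Suc 0"])
    then show ?thesis
      using that fgR nonzerodivisor_on_quot_module_iff[OF module_axioms smult_image_submodule]
      by blast
  qed
  \<comment> \<open>If \<open>g\<close> already belongs to \<open>S\<close>, the adjoined value has
    to be \<open>z g\<close>, since \<open>z'\<close> overwrites the cocycle at
    \<open>g\<close>.\<close>
  obtain zg where zg: "zg \<in> carrier M" "\<And>t. t \<in> S \<Longrightarrow> t \<odot>\<^bsub>M\<^esub> zg = g \<odot>\<^bsub>M\<^esub> z t"
    and zg_eq: "g \<in> S \<Longrightarrow> zg = z g"
  proof (cases "g \<in> S")
    case True
    then show thesis
      using that[of "z g"] z co by blast
  next
    case False
    then show thesis
      using that cocycle_extend_to_ideal[OF order_refl S z _ fgI(2)] co by metis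
  qed
  define z' where "z' = z(g := zg)"
  have "z' \<in> insert g S \<rightarrow> carrier M"
    using z zg by (auto simp: z'_def)
  moreover have "s \<odot>\<^bsub>M\<^esub> z' t = t \<odot>\<^bsub>M\<^esub> z' s" if "s \<in> S" "t \<in> insert g S" for s t
    using that co zg by (auto simp: z'_def)
  ultimately obtain zf where zf: "zf \<in> carrier M" 
    "\<And>t. t \<in> insert g S \<Longrightarrow> t \<odot>\<^bsub>M\<^esub> zf = f \<odot>\<^bsub>M\<^esub> z' t"
    using cocycle_extend_to_ideal[of S "insert g S" z' f] S fgR fgI by blast
  \<comment> \<open>This is the reason for extending over \<open>insert g S\<close>: the instance
    \<open>t = g\<close> links the two adjoined values.\<close>
  have "g \<odot>\<^bsub>M\<^esub> zf = f \<odot>\<^bsub>M\<^esub> zg"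
    using zf(2)[of g] by (simp add: z'_def)
  then obtain y where y: "y \<in> carrier M" "zf = f \<odot>\<^bsub>M\<^esub> y"
    using g_reg zf(1) zg(1) by blast
  have "s \<odot>\<^bsub>M\<^esub> y = z' s" if s: "s \<in> S" for s
  proof -
    have sc: "s \<in> carrier R" "z' s \<in> carrier M"
      using s S z zg by (auto simp: z'_def)
    have "f \<odot>\<^bsub>M\<^esub> (s \<odot>\<^bsub>M\<^esub> y) = s \<odot>\<^bsub>M\<^esub> (f \<odot>\<^bsub>M\<^esub> y)"
      using sc fgR y by (simp add: smult_assoc1[symmetric] R.m_comm)
    also have "\<dots> = f \<odot>\<^bsub>M\<^esub> z' s"
      using zf(2)[of s] s y by simp
    finally have "f \<odot>\<^bsub>M\<^esub> (s \<odot>\<^bsub>M\<^esub> y \<ominus>\<^bsub>M\<^esub> z' s) = \<zero>\<^bsub>M\<^esub>"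
      using sc fgR y by (simp add: a_minus_def smult_r_distr smult_r_minus M.r_neg)
    then have "s \<odot>\<^bsub>M\<^esub> y \<ominus>\<^bsub>M\<^esub> z' s = \<zero>\<^bsub>M\<^esub>"
      by (rule f_reg[rotated]) (use sc y in auto)
    then show ?thesis
      using sc y M.minus_equality M.minus_minus M.a_inv_closed by (metis a_minus_def smult_closed)
  qed
  moreover have "z' s = z s" if "s \<in> S" for s
    using that zg_eq by (auto simp: z'_def)
  ultimately show "\<exists>y\<in>carrier M. \<forall>s\<in>S. s \<odot>\<^bsub>M\<^esub> y = z s"
    using y(1) by auto
qed


section \<open>Krull dimension of quotient rings\<close>

text \<open>Primes above \<open>I\<close> stay prime and distinct in the quotient because they are
  unions of cosets of \<open>I\<close>; \<open>mem\<close> records that a coset lies in the image of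
  \<open>P i\<close> exactly when its representative lies in \<open>P i\<close>.\<close>

lemma krull_dim_Quot_ge:
  fixes R (structure) and P :: "nat \<Rightarrow> 'a set"
  assumes I: "ideal I R" and prime: "\<And>i. i \<le> n \<Longrightarrow> primeideal (P i) R"
    and IP: "I \<subseteq> P 0" and chain: "\<And>i. i < n \<Longrightarrow> P i \<subset> P (Suc i)"
  shows "enat n \<le> krull_dim (R Quot I)"
proof -
  interpret I: ideal I R by (rule I)
  interpret P0: primeideal "P 0" R by (rule prime) simp
  have IPi: "I \<subseteq> P i" if "i \<le> n" for i
    using that by (induction i) (use IP chain in \<open>auto simp: psubset_eq Suc_le_eq\<close>)
  have mem: "I +> x \<in> (+>) I ` P i \<longleftrightarrow> x \<in> P i" if x: "x \<in> carrier R" and i: "i \<le> n" for x i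
  proof
    interpret Pi: primeideal "P i" R by (rule prime[OF i])
    assume "I +> x \<in> (+>) I ` P i"
    then obtain p where p: "p \<in> P i" "I +> x = I +> p" by auto
    then have "x \<ominus> p \<in> P i"
      using I.quotient_eq_iff_same_a_r_cos[OF I x, of p] IPi[OF i] by auto
    then have "(x \<ominus> p) \<oplus> p \<in> P i"
      using p by auto
    moreover have "(x \<ominus> p) \<oplus> p = x"
      using x p by (simp add: I.minus_eq I.a_assoc I.l_neg)
    ultimately show "x \<in> P i" by simp
  qed auto
  have "primeideal ((+>) I ` P i) (R Quot I)" if i: "i \<le> n" for i
  proof (rule primeidealI)
    interpret Pi: primeideal "P i" R by (rule prime[OF i])
    show "ideal ((+>) I ` P i) (R Quot I)"
      by (rule I.ring_ideal_imp_quot_ideal[OF I Pi.is_ideal])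
    show "cring (R Quot I)"
      by (rule I.quotient_is_cring[OF P0.cring_axioms])
    have car: "carrier (R Quot I) = (+>) I ` carrier R"
      by (auto simp: FactRing_def A_RCOSETS_def RCOSETS_def a_r_coset_def)
    obtain x where "x \<in> carrier R" "x \<notin> P i"
      using Pi.I_notcarr Pi.a_subset by auto
    then have "I +> x \<in> carrier (R Quot I)" "I +> x \<notin> (+>) I ` P i"
      using mem[OF _ i] by (simp_all add: car)
    then show "carrier (R Quot I) \<noteq> (+>) I ` P i"
      by metis
    fix a b
    assume "a \<in> carrier (R Quot I)" "b \<in> carrier (R Quot I)"
      and ab: "a \<otimes>\<^bsub>R Quot I\<^esub> b \<in> (+>) I ` P i"
    then obtain x y where xy: "x \<in> carrier R" "a = I +> x" "y \<in> carrier R" "b = I +> y"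
      by (auto simp: car)
    then have "I +> (x \<otimes> y) \<in> (+>) I ` P i"
      using ab by (simp add: FactRing_def I.rcoset_mult_add)
    then show "a \<in> (+>) I ` P i \<or> b \<in> (+>) I ` P i"
      using xy mem[OF _ i] Pi.I_prime by simp
  qed
  moreover have "(+>) I ` P i \<subset> (+>) I ` P (Suc i)" if i: "i < n" for i
  proof -
    obtain x where x: "x \<in> P (Suc i)" "x \<notin> P i"
      using chain[OF i] by blast
    moreover have "x \<in> carrier R"
      using x(1) ideal.Icarr[OF primeideal.axioms(1)[OF prime[of "Suc i"]]] i by simp
    ultimately show ?thesis
      using mem[of x i] chain[OF i] i by (auto simp: psubset_eq)
  qed
  ultimately show ?thesis
    unfolding krull_dim_def by (intro SUP_upper CollectI exI[of _ "\<lambda>i. (+>) I ` P i"]) blast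
qed


section \<open>Depth at least two\<close>

lemma (in module) Koszul_H1_vanishes_if_depth_ge_2:
  assumes "S \<subseteq> carrier R" "2 \<le> module_depth (Idl S) M"
  shows "Koszul_H1_vanishes S M"
proof -
  obtain xs where "set xs \<subseteq> Idl S" "regular_sequence xs M" "length xs \<ge> 2"
  proof (rule ccontr)
    \<comment> \<open>Depth is a supremum in \<open>enat\<close>, so no maximal sequence is at hand;
      but if all lengths were at most 1, the supremum would be too.\<close>
    assume "\<not> thesis"
    then have "\<forall>xs\<in>{xs. set xs \<subseteq> Idl S \<and> regular_sequence xs M}. enat (length xs) \<le> enat 1"
      using that by force
    then have "module_depth (Idl S) M \<le> enat 1"
      unfolding module_depth_def by (intro SUP_least) blast
    with assms(2) have "(2::enat) \<le> enat 1" by (rule order_trans)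
    then show False by (simp add: numeral_eq_enat)
  qed
  then show ?thesis
    using Koszul_H1_vanishes_if_regular_pair assms(1) by blast
qed

text \<open>The hypothesis \<open>dim\<close> speaks of the quotient of \<open>N\<close> by zero
  because this is literally the first factor of a filtration, and any nonzero submodule may occur as
  its first step.\<close>

lemma (in module) Koszul_H1_vanishes_if_sequentially_Cohen_Macaulay:
  assumes S: "S \<subseteq> carrier R" and scm: "sequentially_Cohen_Macaulay R (Idl S) \<Gamma> M"
    and dim: "\<And>N. submodule N R M \<Longrightarrow> N \<noteq> {\<zero>\<^bsub>M\<^esub>} \<Longrightarrow>
      2 \<le> module_dim R (quot_module (M\<lparr>carrier := N\<rparr>) {\<zero>\<^bsub>M\<^esub>})"
  shows "Koszul_H1_vanishes S M"
proof -
  obtain r F where F0: "F 0 = {\<zero>\<^bsub>M\<^esub>}" and Fr: "F r = carrier M"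
    and gr: "\<And>i. i \<le> r \<Longrightarrow> graded_submodule R \<Gamma> M (F i)"
    and inc: "\<And>i. i < r \<Longrightarrow> F i \<subset> F (Suc i)"
    and CM: "\<And>i. i < r \<Longrightarrow> Cohen_Macaulay R (Idl S) (quot_module (M\<lparr>carrier := F (Suc i)\<rparr>) (F i))"
    and dims: "\<And>i. Suc i < r \<Longrightarrow>
           module_dim R (quot_module (M\<lparr>carrier := F (Suc i)\<rparr>) (F i))
           < module_dim R (quot_module (M\<lparr>carrier := F (Suc (Suc i))\<rparr>) (F (Suc i)))"
    using scm unfolding sequentially_Cohen_Macaulay_def by auto
  have sub: "submodule (F i) R M" if "i \<le> r" for i
    using gr[OF that] by (simp add: graded_submodule_def)
  have dim_F: "2 \<le> module_dim R (quot_module (M\<lparr>carrier := F (Suc i)\<rparr>) (F i))" if "i < r" for i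
    using that
  proof (induction i)
    case 0
    then show ?case
      using dim[OF sub[of "Suc 0"]] inc[of 0] by (auto simp: F0)
  next
    case (Suc i)
    then show ?case
      using dims[of i] by force
  qed
  have "Koszul_H1_vanishes S (M\<lparr>carrier := F i\<rparr>)" if "i \<le> r" for i
    using that
  proof (induction i)
    case 0
    interpret F: module R "M\<lparr>carrier := F 0\<rparr>"
      by (rule submodule.submodule_is_module[OF sub[OF 0] module_axioms])
    show ?case
      by (rule F.Koszul_H1_vanishes_trivial[OF S]) (simp add: F0)
  next
    case (Suc i)
    interpret F: module R "M\<lparr>carrier := F (Suc i)\<rparr>"
      by (rule submodule.submodule_is_module[OF sub[OF Suc.prems] module_axioms])
    have subF: "submodule (F i) R (M\<lparr>carrier := F (Suc i)\<rparr>)"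
      using Suc.prems inc[of i] by (intro submodule_restrict sub) auto
    interpret Q: module R "quot_module (M\<lparr>carrier := F (Suc i)\<rparr>) (F i)"
      by (rule quot_module_module[OF F.module_axioms subF])
    have "Koszul_H1_vanishes S (quot_module (M\<lparr>carrier := F (Suc i)\<rparr>) (F i))"
      using CM[of i] dim_F[of i] Suc.prems S
      by (intro Q.Koszul_H1_vanishes_if_depth_ge_2) (auto simp: Cohen_Macaulay_def)
    then show ?case
      using Suc by (intro F.Koszul_H1_vanishes_extension[OF subF S]) auto
  qed
  from this[of r] show ?thesis
    by (simp add: Fr)
qed


section \<open>Monomials and face ideals\<close>

text \<open>Natural exponents cannot cancel, hence an equality and not just an inclusion.\<close>

lemma keys_add_nat: "Poly_Mapping.keys (s + t) = Poly_Mapping.keys s \<union> Poly_Mapping.keys t"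
  for s t :: "'v \<Rightarrow>\<^sub>0 nat"
  by (auto simp: in_keys_iff lookup_add)

lemma poly_mapping_eq_sum_single:
  "p = (\<Sum>t\<in>Poly_Mapping.keys p. Poly_Mapping.single t (Poly_Mapping.lookup p t))"
  by (rule poly_mapping_eqI) (auto simp: lookup_sum lookup_single when_def in_keys_iff)

text \<open>The convolution sum keeps at most one term. Neither \<open>s\<close> nor
  \<open>t\<close> has to occur in \<open>p\<close> or \<open>q\<close>, as both sides are then 0;
  \<open>lookup_var_mult\<close> relies on this for \<open>t = 0\<close>.\<close>

lemma lookup_mult_unique_sum:
  fixes p q :: "'a::monoid_add \<Rightarrow>\<^sub>0 'k::semiring_0"
  assumes uniq: "\<And>s' t'. s' \<in> Poly_Mapping.keys p \<Longrightarrow> t' \<in> Poly_Mapping.keys q \<Longrightarrow>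
    s' + t' = s + t \<Longrightarrow> s' = s \<and> t' = t"
  shows "Poly_Mapping.lookup (p * q) (s + t) = Poly_Mapping.lookup p s * Poly_Mapping.lookup q t"
proof -
  let ?p = "Poly_Mapping.lookup p" and ?q = "Poly_Mapping.lookup q"
  have "p * q = (\<Sum>s'\<in>Poly_Mapping.keys p. \<Sum>t'\<in>Poly_Mapping.keys q.
      Poly_Mapping.single (s' + t') (?p s' * ?q t'))"
    by (subst poly_mapping_eq_sum_single[of p], subst poly_mapping_eq_sum_single[of q])
      (simp add: sum_product mult_single)
  then have "Poly_Mapping.lookup (p * q) (s + t) =
      (\<Sum>s'\<in>Poly_Mapping.keys p. \<Sum>t'\<in>Poly_Mapping.keys q. (?p s' * ?q t') when s' + t' = s + t)"
    by (simp add: lookup_sum lookup_single)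
  also have "\<dots> = (\<Sum>s'\<in>Poly_Mapping.keys p. \<Sum>t'\<in>Poly_Mapping.keys q.
      if t' = t then (if s' = s then ?p s' * ?q t' else 0) else 0)"
    using uniq by (intro sum.cong refl) (auto simp: when_def)
  also have "\<dots> = (\<Sum>s'\<in>Poly_Mapping.keys p. if s' = s then ?p s' * ?q t else 0)"
    by (intro sum.cong refl, subst sum.delta) (auto simp: in_keys_iff)
  also have "\<dots> = ?p s * ?q t"
    by (subst sum.delta) (auto simp: in_keys_iff)
  finally show ?thesis .
qed

text \<open>Picking in each variable the largest exponents isolates a pair of monomials that no other pair
  can cancel, which makes products of nonzero polynomials nonzero without fixing a monomial order.\<close>

lemma unique_sum_pair:
  fixes S T :: "('v \<Rightarrow>\<^sub>0 nat) set"
  assumes "finite V" and "finite S" "S \<noteq> {}" "finite T" "T \<noteq> {}"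
    and "\<And>s s' v. s \<in> S \<Longrightarrow> s' \<in> S \<Longrightarrow> v \<notin> V \<Longrightarrow> Poly_Mapping.lookup s v = Poly_Mapping.lookup s' v"
    and "\<And>t t' v. t \<in> T \<Longrightarrow> t' \<in> T \<Longrightarrow> v \<notin> V \<Longrightarrow> Poly_Mapping.lookup t v = Poly_Mapping.lookup t' v"
  shows "\<exists>s\<in>S. \<exists>t\<in>T. \<forall>s'\<in>S. \<forall>t'\<in>T. s' + t' = s + t \<longrightarrow> s' = s \<and> t' = t"
  using assms
proof (induction V arbitrary: S T)
  case empty
  \<comment> \<open>\<open>V\<close> holds the variables in which two members may still differ; once
    it is empty, each set has a single member.\<close>
  have "s = s'" if "s \<in> S" "s' \<in> S" for s s'
    by (rule poly_mapping_eqI, rule empty(5)[OF that]) simp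
  moreover have "t = t'" if "t \<in> T" "t' \<in> T" for t t'
    by (rule poly_mapping_eqI, rule empty(6)[OF that]) simp
  ultimately show ?case
    using empty(2,4) by blast
next
  case (insert v V)
  define mS where "mS = Max ((\<lambda>s. Poly_Mapping.lookup s v) ` S)"
  define mT where "mT = Max ((\<lambda>s. Poly_Mapping.lookup s v) ` T)"
  define S' where "S' = {s\<in>S. Poly_Mapping.lookup s v = mS}"
  define T' where "T' = {t\<in>T. Poly_Mapping.lookup t v = mT}"
  have le: "Poly_Mapping.lookup s v \<le> mS" if "s \<in> S" for s
    using that insert.prems(1-4) by (simp add: mS_def)
  have le': "Poly_Mapping.lookup t v \<le> mT" if "t \<in> T" for t
    using that insert.prems(1-4) by (simp add: mT_def)
  have "mS \<in> (\<lambda>s. Poly_Mapping.lookup s v) ` S" "mT \<in> (\<lambda>s. Poly_Mapping.lookup s v) ` T"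
    using insert.prems(1-4) by (simp_all add: mS_def mT_def)
  then have ne: "S' \<noteq> {}" "T' \<noteq> {}"
    by (auto simp: S'_def T'_def)
  have "\<exists>s\<in>S'. \<exists>t\<in>T'. \<forall>s'\<in>S'. \<forall>t'\<in>T'. s' + t' = s + t \<longrightarrow> s' = s \<and> t' = t"
  proof (rule insert.IH)
    show "finite S'" "finite T'"
      using insert.prems(1-4) by (simp_all add: S'_def T'_def)
    show "Poly_Mapping.lookup s w = Poly_Mapping.lookup s' w" if "s \<in> S'" "s' \<in> S'" "w \<notin> V" for s s' w
      using that insert.prems(5)[of s s' w] by (cases "w = v") (auto simp: S'_def)
    show "Poly_Mapping.lookup s w = Poly_Mapping.lookup s' w" if "s \<in> T'" "s' \<in> T'" "w \<notin> V" for s s' w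
      using that insert.prems(6)[of s s' w] by (cases "w = v") (auto simp: T'_def)
  qed (rule ne)+
  then obtain s t where st: "s \<in> S'" "t \<in> T'"
    "\<And>s' t'. s' \<in> S' \<Longrightarrow> t' \<in> T' \<Longrightarrow> s' + t' = s + t \<Longrightarrow> s' = s \<and> t' = t" by blast
  have "s' = s \<and> t' = t" if st': "s' \<in> S" "t' \<in> T" and eq: "s' + t' = s + t" for s' t'
  proof -
    \<comment> \<open>Two exponents bounded by \<open>mS\<close> and \<open>mT\<close> with sum
      \<open>mS + mT\<close> both attain their bounds, so a competing pair already lies in the
      restricted sets.\<close>
    have "Poly_Mapping.lookup s' v + Poly_Mapping.lookup t' v = mS + mT"
      using arg_cong[OF eq, of "\<lambda>u. Poly_Mapping.lookup u v"] st(1,2)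
      by (simp add: lookup_add S'_def T'_def)
    then have "Poly_Mapping.lookup s' v = mS" "Poly_Mapping.lookup t' v = mT"
      using le[OF st'(1)] le'[OF st'(2)] by linarith+
    then show ?thesis
      using st(3)[of s' t'] st' eq by (simp add: S'_def T'_def)
  qed
  then show ?case
    using st(1,2) unfolding S'_def T'_def by blast
qed

section \<open>The polynomial ring and its monomial ideals\<close>

lemma poly_ring_simps [simp]:
  "carrier (poly_ring V) = {p. \<forall>t\<in>Poly_Mapping.keys p. Poly_Mapping.keys t \<subseteq> V}"
  "mult (poly_ring V) = (*)" "one (poly_ring V) = 1" "zero (poly_ring V) = 0"
  "add (poly_ring V) = (+)"
  by (simp_all add: poly_ring_def)

lemma poly_ring_a_inv:
  assumes "p \<in> carrier (poly_ring V)"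
  shows "\<ominus>\<^bsub>poly_ring V\<^esub> p = - p"
proof -
  interpret cring "poly_ring V" by (rule poly_ring_cring)
  show ?thesis
    using assms by (intro minus_equality) (auto simp: in_keys_iff)
qed

lemma var_in_poly_ring [simp]: "v \<in> V \<Longrightarrow> var v \<in> carrier (poly_ring V)"
  by (simp add: var_def)

text \<open>Cochains are indexed by the polynomials \<open>var v\<close>; injectivity lets one be
  prescribed vertex by vertex.\<close>

lemma inj_var: "inj (var :: 'v \<Rightarrow> ('v, 'k::field) mpolynomial)"
proof (rule injI)
  fix v w :: 'v
  assume "(var v :: ('v, 'k) mpolynomial) = var w"
  then have "Poly_Mapping.keys (var v :: ('v, 'k) mpolynomial) = Poly_Mapping.keys (var w :: ('v, 'k) mpolynomial)"
    by simp
  then have "Poly_Mapping.single v (1::nat) = Poly_Mapping.single w 1"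
    by (simp add: var_def)
  then have "Poly_Mapping.keys (Poly_Mapping.single v (1::nat)) = Poly_Mapping.keys (Poly_Mapping.single w (1::nat))"
    by simp
  then show "v = w"
    by simp
qed

text \<open>Every monomial of a product is a sum of exponents from both factors, so a condition
  stable under adding exponents survives. Face ideals and edge ideals are both of this kind.\<close>

lemma monomial_ideal:
  fixes V :: "'v set"
  assumes up: "\<And>s t. Q t \<Longrightarrow> Q (s + t)"
  shows "ideal {p \<in> carrier (poly_ring V :: ('v, 'k::field) mpolynomial ring). \<forall>t\<in>Poly_Mapping.keys p. Q t}
    (poly_ring V)"
    (is "ideal ?I ?R")
proof (rule idealI)
  interpret cring ?R by (rule poly_ring_cring)
  show "ring ?R" by (rule ring_axioms)
  show "subgroup ?I (add_monoid ?R)"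
  proof (rule add.subgroupI)
    have "0 \<in> ?I" by simp
    then show "?I \<noteq> {}" by blast
    show "\<ominus>\<^bsub>?R\<^esub> p \<in> ?I" if "p \<in> ?I" for p
      using that poly_ring_a_inv[of p V] by (auto simp: in_keys_iff)
    show "p \<oplus>\<^bsub>?R\<^esub> q \<in> ?I" if "p \<in> ?I" "q \<in> ?I" for p q
      using that Poly_Mapping.keys_add[of p q] by simp blast
  qed auto
  show l: "x \<otimes>\<^bsub>?R\<^esub> a \<in> ?I" if "a \<in> ?I" "x \<in> carrier ?R" for a x
  proof -
    have "x \<otimes>\<^bsub>?R\<^esub> a \<in> carrier ?R"
      using that by (intro m_closed) auto
    moreover have "Q t" if t: "t \<in> Poly_Mapping.keys (x * a)" for t
      using keys_mult[of x a] t up \<open>a \<in> ?I\<close> by auto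
    ultimately show ?thesis by simp
  qed
  show "a \<otimes>\<^bsub>?R\<^esub> x \<in> ?I" if "a \<in> ?I" "x \<in> carrier ?R" for a x
    using l[OF that] by (simp add: mult.commute)
qed

text \<open>This is the ideal generated by the variables of \<open>V\<close> outside
  \<open>F\<close>, that is, the kernel of setting these variables to 0.\<close>

definition face_ideal :: "'v set \<Rightarrow> 'v set \<Rightarrow> ('v, 'k::field) mpolynomial set" where
  "face_ideal V F = {p \<in> carrier (poly_ring V). \<forall>t\<in>Poly_Mapping.keys p. \<not> Poly_Mapping.keys t \<subseteq> F}"

lemma face_ideal_prime:
  assumes "finite F"
  shows "primeideal (face_ideal V F :: ('v, 'k::field) mpolynomial set) (poly_ring V)"
proof (rule primeidealI)
  let ?R = "poly_ring V :: ('v, 'k) mpolynomial ring" and ?P = "face_ideal V F :: ('v, 'k) mpolynomial set"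
  show "cring ?R" by (rule poly_ring_cring)
  show "ideal ?P ?R"
    unfolding face_ideal_def by (rule monomial_ideal) (auto simp: keys_add_nat)
  have "1 \<in> carrier ?R" "1 \<notin> ?P"
    by (simp_all add: face_ideal_def)
  then show "carrier ?R \<noteq> ?P" by blast
  fix p q assume pq: "p \<in> carrier ?R" "q \<in> carrier ?R" "p \<otimes>\<^bsub>?R\<^esub> q \<in> ?P"
  show "p \<in> ?P \<or> q \<in> ?P"
  proof (rule ccontr)
    define S where "S = {t\<in>Poly_Mapping.keys p. Poly_Mapping.keys t \<subseteq> F}"
    define T where "T = {t\<in>Poly_Mapping.keys q. Poly_Mapping.keys t \<subseteq> F}"
    assume "\<not> (p \<in> ?P \<or> q \<in> ?P)"
    then have "S \<noteq> {}" "T \<noteq> {}"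
      using pq by (auto simp: face_ideal_def S_def T_def)
    moreover have "Poly_Mapping.lookup s v = 0" if "s \<in> S \<union> T" "v \<notin> F" for s v
      using that by (auto simp: S_def T_def simp flip: not_in_keys_iff_lookup_eq_zero)
    ultimately have "\<exists>s\<in>S. \<exists>t\<in>T. \<forall>s'\<in>S. \<forall>t'\<in>T. s' + t' = s + t \<longrightarrow> s' = s \<and> t' = t"
      using assms by (intro unique_sum_pair[of F]) (simp_all add: S_def T_def)
    then obtain s t where st: "s \<in> S" "t \<in> T"
      "\<And>s' t'. s' \<in> S \<Longrightarrow> t' \<in> T \<Longrightarrow> s' + t' = s + t \<Longrightarrow> s' = s \<and> t' = t" by blast
    have F: "Poly_Mapping.keys (s + t) \<subseteq> F"
      using st by (auto simp: keys_add_nat S_def T_def)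
    \<comment> \<open>Uniqueness was obtained only among monomials supported in \<open>F\<close>. It
      extends to all of \<open>p\<close> and \<open>q\<close>, since the summands of a monomial
      supported in \<open>F\<close> are themselves supported in \<open>F\<close>.\<close>
    have "Poly_Mapping.lookup (p * q) (s + t) = Poly_Mapping.lookup p s * Poly_Mapping.lookup q t"
    proof (rule lookup_mult_unique_sum)
      fix s' t' assume *: "s' \<in> Poly_Mapping.keys p" "t' \<in> Poly_Mapping.keys q" "s' + t' = s + t"
      then have "Poly_Mapping.keys s' \<union> Poly_Mapping.keys t' \<subseteq> F"
        using F by (simp flip: keys_add_nat)
      then have "s' \<in> S" "t' \<in> T"
        using * by (simp_all add: S_def T_def)
      then show "s' = s \<and> t' = t"
        using st(3) * by blast
    qed
    also have "\<dots> \<noteq> 0"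
      using st by (simp add: S_def T_def in_keys_iff)
    finally have "s + t \<in> Poly_Mapping.keys (p * q)"
      by (simp add: in_keys_iff)
    then show False
      using F pq(3) by (auto simp: face_ideal_def)
  qed
qed

lemma face_ideal_psubset:
  assumes "v \<in> V" "v \<in> F"
  shows "face_ideal V F \<subset> (face_ideal V (F - {v}) :: ('v, 'k::field) mpolynomial set)"
proof -
  have "var v \<in> (face_ideal V (F - {v}) :: ('v, 'k) mpolynomial set)"
    "var v \<notin> (face_ideal V F :: ('v, 'k) mpolynomial set)"
    using assms by (auto simp: face_ideal_def var_def)
  moreover have "face_ideal V F \<subseteq> (face_ideal V (F - {v}) :: ('v, 'k) mpolynomial set)"
    by (auto simp: face_ideal_def)
  ultimately show ?thesis by blast
qed

section \<open>The edge ideal as a squarefree monomial ideal\<close>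

lemma var_times_var_keys:
  "Poly_Mapping.keys (var x * var y :: ('v, 'k::field) mpolynomial) =
     {Poly_Mapping.single x 1 + Poly_Mapping.single y 1}"
  by (simp add: var_def mult_single)

text \<open>The generators are squarefree monomials, so divisibility by one of them depends only on
  the support: a monomial is outside the ideal exactly when its support is a face of the
  independence complex.\<close>

lemma edge_ideal_eq:
  assumes G: "simple_graph G"
  shows "(edge_ideal G :: ('v, 'k::field) mpolynomial set) =
    {p \<in> carrier (poly_ring (verts G)). \<forall>t\<in>Poly_Mapping.keys p. \<exists>e\<in>edges G. e \<subseteq> Poly_Mapping.keys t}"
    (is "_ = ?I")
proof
  let ?R = "poly_ring (verts G) :: ('v, 'k) mpolynomial ring"
  let ?E = "{var x * var y |x y. {x, y} \<in> edges G} :: ('v, 'k) mpolynomial set"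
  interpret cring ?R by (rule poly_ring_cring)
  have E: "x \<noteq> y" "x \<in> verts G" "y \<in> verts G" if xy: "{x, y} \<in> edges G" for x y
  proof -
    obtain u v where "{x, y} = {u, v}" "u \<noteq> v" "u \<in> verts G" "v \<in> verts G"
      using G[unfolded simple_graph_def, THEN conjunct2, rule_format, OF xy] by blast
    then show "x \<noteq> y" "x \<in> verts G" "y \<in> verts G"
      by (auto simp: doubleton_eq_iff)
  qed
  have EI: "?E \<subseteq> ?I"
  proof
    fix p assume "p \<in> ?E"
    then obtain x y where xy: "p = var x * var y" "{x, y} \<in> edges G" by blast
    then show "p \<in> ?I"
      using E[OF xy(2)] by (auto simp: var_times_var_keys keys_add_nat intro!: bexI[of _ "{x, y}"])
  qed
  have "ideal ?I ?R"
    by (rule monomial_ideal) (auto simp: keys_add_nat)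
  then show "edge_ideal G \<subseteq> ?I"
    unfolding edge_ideal_def using EI by (rule genideal_minimal)
  have EC: "?E \<subseteq> carrier ?R"
    using EI by blast
  interpret I: ideal "edge_ideal G" ?R
    unfolding edge_ideal_def by (rule genideal_ideal[OF EC])
  show "?I \<subseteq> edge_ideal G"
  proof
    fix p assume p: "p \<in> ?I"
    have mono: "Poly_Mapping.single t c \<in> edge_ideal G" if t: "t \<in> Poly_Mapping.keys p" for t and c :: 'k
    proof -
      obtain e where "e \<in> edges G" "e \<subseteq> Poly_Mapping.keys t"
        using p t by auto
      moreover then obtain x y where "e = {x, y}"
        using G unfolding simple_graph_def by meson
      ultimately have xy: "{x, y} \<in> edges G" "x \<in> Poly_Mapping.keys t" "y \<in> Poly_Mapping.keys t" by auto
      define m :: "'v \<Rightarrow>\<^sub>0 nat" where "m = Poly_Mapping.single x 1 + Poly_Mapping.single y 1"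
      \<comment> \<open>Subtraction of exponents is truncated; it is exact here because
        \<open>x\<close> and \<open>y\<close> are distinct and both occur in
        \<open>t\<close>.\<close>
      have split: "t = (t - m) + m"
        using xy E(1)[OF xy(1)]
        by (intro poly_mapping_eqI) (auto simp: m_def lookup_add lookup_minus lookup_single when_def in_keys_iff)
      have "Poly_Mapping.keys (t - m) \<subseteq> Poly_Mapping.keys t"
        using split keys_add_nat[of "t - m" m] by simp
      also have "\<dots> \<subseteq> verts G"
        using p t by auto
      finally have "Poly_Mapping.keys (t - m) \<subseteq> verts G" .
      then have "Poly_Mapping.single (t - m) c \<in> carrier ?R"
        by simp
      moreover have "var x * var y \<in> ?E"
        using xy(1) by blast
      then have "var x * var y \<in> (edge_ideal G :: ('v, 'k) mpolynomial set)"
        unfolding edge_ideal_def by (rule subsetD[OF genideal_self[OF EC]])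
      ultimately have "Poly_Mapping.single (t - m) c * (var x * var y) \<in> edge_ideal G"
        using I.I_l_closed[of "var x * var y" "Poly_Mapping.single (t - m) c"] by simp
      also have "Poly_Mapping.single (t - m) c * (var x * var y) = Poly_Mapping.single t c"
        by (subst (2) split) (simp add: var_def mult_single m_def)
      finally show ?thesis .
    qed
    have "(\<Sum>t\<in>K. Poly_Mapping.single t (Poly_Mapping.lookup p t)) \<in> edge_ideal G"
      if "finite K" "K \<subseteq> Poly_Mapping.keys p" for K
      using that
    proof (induction K)
      case empty
      then show ?case using I.zero_closed by simp
    next
      case (insert t K)
      then show ?case
        using I.a_closed[of "Poly_Mapping.single t (Poly_Mapping.lookup p t)"] mono by simp
    qed
    from this[of "Poly_Mapping.keys p"] show "p \<in> edge_ideal G"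
      by (simp flip: poly_mapping_eq_sum_single)
  qed
qed

lemma lookup_var_mult:
  "Poly_Mapping.lookup (var v * p) (Poly_Mapping.single v 1) = Poly_Mapping.lookup p 0"
proof -
  have "Poly_Mapping.lookup (var v * p) (Poly_Mapping.single v 1 + 0) =
      Poly_Mapping.lookup (var v) (Poly_Mapping.single v 1) * Poly_Mapping.lookup p 0"
    by (rule lookup_mult_unique_sum) (simp_all add: var_def)
  then show ?thesis by (simp add: var_def)
qed


section \<open>Edge modules\<close>

lemma edge_ideal_ideal: "simple_graph G \<Longrightarrow> ideal (edge_ideal G) (poly_ring (verts G))"
  unfolding edge_ideal_eq by (rule monomial_ideal) (auto simp: keys_add_nat)

lemma poly_ring_self_module: "module (poly_ring V) (self_module (poly_ring V))"
  by (rule self_module_module[OF poly_ring_cring])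

lemma self_module_simps [simp]:
  "carrier (self_module R) = carrier R" "zero (self_module R) = zero R"
  "add (self_module R) = add R" "smult (self_module R) = mult R"
  by (simp_all add: self_module_def)

lemma self_module_minus:
  assumes "p \<in> carrier (poly_ring V)" "q \<in> carrier (poly_ring V)"
  shows "p \<ominus>\<^bsub>self_module (poly_ring V)\<^esub> q = p - q"
proof -
  have "\<ominus>\<^bsub>self_module (poly_ring V)\<^esub> q = \<ominus>\<^bsub>poly_ring V\<^esub> q"
    by (simp add: a_inv_def m_inv_def)
  then show ?thesis
    using assms(2) by (simp add: a_minus_def poly_ring_a_inv)
qed

lemma edge_ideal_submodule:
  assumes "simple_graph G"
  shows "submodule (edge_ideal G) (poly_ring (verts G)) (self_module (poly_ring (verts G)))"
proof -
  let ?R = "poly_ring (verts G)"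
  interpret ideal "edge_ideal G" ?R by (rule edge_ideal_ideal[OF assms])
  have "subgroup (edge_ideal G) (add_monoid (self_module ?R))"
    using a_subgroup by (simp add: subgroup_def m_inv_def)
  then show ?thesis
    using I_l_closed by (intro submodule.intro submodule_axioms.intro) auto
qed

definition edge_class :: "'v ugraph \<Rightarrow> ('v, 'k::field) mpolynomial \<Rightarrow> ('v, 'k) mpolynomial set" where
  "edge_class G p = edge_ideal G +>\<^bsub>self_module (poly_ring (verts G))\<^esub> p"

lemma carrier_edge_module: "carrier (edge_module G) = edge_class G ` carrier (poly_ring (verts G))"
  by (simp add: edge_module_def carrier_quot_module edge_class_def del: poly_ring_simps)

lemma zero_edge_module: "\<zero>\<^bsub>edge_module G\<^esub> = edge_ideal G"
  by (simp add: edge_module_def)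

context
  fixes G :: "'v ugraph"
  assumes G: "simple_graph G"
begin

lemma edge_module_module: "module (poly_ring (verts G)) (edge_module G :: (_, ('v, 'k::field) mpolynomial set) module)"
  unfolding edge_module_def by (rule quot_module_module[OF poly_ring_self_module edge_ideal_submodule[OF G]])

lemma smult_edge_class:
  assumes "p \<in> carrier (poly_ring (verts G))" "q \<in> carrier (poly_ring (verts G))"
  shows "p \<odot>\<^bsub>edge_module G\<^esub> edge_class G q = edge_class G (p * q)"
  using quot_module_smult[OF poly_ring_self_module edge_ideal_submodule[OF G], of p q] assms
  by (simp add: edge_module_def edge_class_def)

lemma edge_class_eq_iff:
  assumes "p \<in> carrier (poly_ring (verts G))" "q \<in> carrier (poly_ring (verts G))"
  shows "edge_class G p = edge_class G q \<longleftrightarrow> p - q \<in> edge_ideal G"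
  using quot_module_coset_eq_iff[OF poly_ring_self_module edge_ideal_submodule[OF G], of p q] assms
    self_module_minus[OF assms]
  by (simp add: edge_class_def)

lemma edge_class_eq_zero_iff:
  assumes "p \<in> carrier (poly_ring (verts G))"
  shows "edge_class G p = edge_ideal G \<longleftrightarrow> p \<in> edge_ideal G"
  using quot_module_coset_zero_iff[OF poly_ring_self_module edge_ideal_submodule[OF G], of p] assms
  by (simp add: edge_class_def)

end

section \<open>Faces of the independence complex and dimensions of submodules\<close>

definition independent_set :: "'v ugraph \<Rightarrow> 'v set \<Rightarrow> bool" where
  "independent_set G F \<longleftrightarrow> F \<subseteq> verts G \<and> (\<forall>e\<in>edges G. \<not> e \<subseteq> F)"

lemma edge_ideal_subset_face_ideal:
  assumes "simple_graph G" "independent_set G F"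
  shows "edge_ideal G \<subseteq> face_ideal (verts G) F"
proof
  fix p assume "p \<in> edge_ideal G"
  then have p: "p \<in> carrier (poly_ring (verts G))"
    "\<And>t. t \<in> Poly_Mapping.keys p \<Longrightarrow> \<exists>e\<in>edges G. e \<subseteq> Poly_Mapping.keys t"
    by (simp_all add: edge_ideal_eq[OF assms(1)])
  have "\<not> Poly_Mapping.keys t \<subseteq> F" if "t \<in> Poly_Mapping.keys p" for t
    using p(2)[OF that] assms(2) unfolding independent_set_def by blast
  with p(1) show "p \<in> face_ideal (verts G) F"
    unfolding face_ideal_def by blast
qed

text \<open>A nonzero class in \<open>N\<close> survives on some face \<open>F\<close> with two
  vertices, so the prime of \<open>F\<close> contains the annihilator of \<open>N\<close>. Deleting
  two vertices from \<open>F\<close> in turn gives a chain of three primes starting there.\<close>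

lemma submodule_edge_module_dim_ge_2:
  fixes G :: "'v ugraph" and N :: "('v, 'k::field) mpolynomial set set"
  assumes G: "simple_graph G"
    and extend: "\<And>F. independent_set G F \<Longrightarrow>
      \<exists>F'. F \<subseteq> F' \<and> independent_set G F' \<and> (\<exists>v\<in>F'. \<exists>w\<in>F'. v \<noteq> w)"
    and N: "submodule N (poly_ring (verts G)) (edge_module G)" "N \<noteq> {\<zero>\<^bsub>edge_module G\<^esub>}"
  shows "2 \<le> module_dim (poly_ring (verts G))
    (quot_module ((edge_module G)\<lparr>carrier := N\<rparr>) {\<zero>\<^bsub>edge_module G\<^esub>})"
proof -
  let ?V = "verts G"
  let ?R = "poly_ring ?V :: ('v, 'k) mpolynomial ring"
  let ?M = "edge_module G :: (_, ('v, 'k) mpolynomial set) module"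
  let ?N = "?M\<lparr>carrier := N\<rparr>"
  interpret M: module ?R ?M by (rule edge_module_module[OF G])
  interpret N: module ?R ?N
    by (rule submodule.submodule_is_module[OF N(1) M.module_axioms])
  have sub0: "submodule {\<zero>\<^bsub>?M\<^esub>} ?R ?N"
    using N.zero_submodule by simp
  interpret Q: module ?R "quot_module ?N {\<zero>\<^bsub>?M\<^esub>}"
    by (rule quot_module_module[OF N.module_axioms sub0])
  let ?J = "annihilator ?R (quot_module ?N {\<zero>\<^bsub>?M\<^esub>})"
  have "\<zero>\<^bsub>?M\<^esub> \<in> N"
    using N.M.zero_closed by simp
  then obtain z where z: "z \<in> N" "z \<noteq> \<zero>\<^bsub>?M\<^esub>"
    using N(2) by blast
  then have "z \<in> carrier ?M"
    using M.submoduleE(1)[OF N(1)] by blast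
  then obtain g where g: "g \<in> carrier ?R" "z = edge_class G g"
    unfolding carrier_edge_module by blast
  then have g': "g \<notin> edge_ideal G" "edge_class G g \<in> N"
    using z edge_class_eq_zero_iff[OF G g(1)] by (simp_all add: zero_edge_module)
  then obtain t where t: "t \<in> Poly_Mapping.keys g" "independent_set G (Poly_Mapping.keys t)"
    using g(1) by (auto simp: edge_ideal_eq[OF G] independent_set_def)
  obtain F v w where F: "Poly_Mapping.keys t \<subseteq> F" "independent_set G F"
    and vw: "v \<in> F" "w \<in> F" "v \<noteq> w"
    using extend[OF t(2)] by blast
  have FV: "F \<subseteq> ?V" and finF: "finite F"
    using F(2) G finite_subset by (auto simp: independent_set_def simple_graph_def)
  have g_F: "g \<notin> face_ideal ?V F"
    using t(1) F(1) by (auto simp: face_ideal_def)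
  interpret P: primeideal "face_ideal ?V F" ?R
    by (rule face_ideal_prime[OF finF])
  have J: "?J \<subseteq> face_ideal ?V F"
  proof
    fix r assume "r \<in> ?J"
    then have r: "r \<in> carrier ?R" "r \<odot>\<^bsub>?M\<^esub> edge_class G g = \<zero>\<^bsub>?M\<^esub>"
      using g'(2) annihilator_quot_module[OF N.module_axioms sub0] by auto
    then have "r * g \<in> edge_ideal G"
      using g(1) edge_class_eq_zero_iff[OF G, of "r * g"] M.R.m_closed[of r g]
      by (simp add: smult_edge_class[OF G] zero_edge_module)
    \<comment> \<open>The product lies in the prime of \<open>F\<close> and \<open>g\<close> does
      not, so \<open>r\<close> does.\<close>
    then have "r \<otimes>\<^bsub>?R\<^esub> g \<in> face_ideal ?V F"
      using edge_ideal_subset_face_ideal[OF G F(2)] by auto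
    then show "r \<in> face_ideal ?V F"
      using P.I_prime[OF r(1) g(1)] g_F by blast
  qed
  define P :: "nat \<Rightarrow> ('v, 'k) mpolynomial set"
    where "P i = face_ideal ?V (if i = 0 then F else if i = 1 then F - {v} else F - {v} - {w})" for i
  have "enat 2 \<le> krull_dim (?R Quot ?J)"
  proof (rule krull_dim_Quot_ge[where P = P])
    show "ideal ?J ?R" by (rule Q.annihilator_ideal)
    show "primeideal (P i) ?R" for i
      unfolding P_def using finF by (intro face_ideal_prime) auto
    show "?J \<subseteq> P 0"
      using J by (simp add: P_def)
    show "P i \<subset> P (Suc i)" if "i < 2" for i
    proof -
      have "i = 0 \<or> i = 1" using that by auto
      then show ?thesis
        using vw FV face_ideal_psubset[of v ?V F] face_ideal_psubset[of w ?V "F - {v}"]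
        unfolding P_def by auto
    qed
  qed
  then show ?thesis
    by (simp add: module_dim_def numeral_eq_enat)
qed

text \<open>The cocycle below is \<open>v\<close> on one side of the join and \<open>0\<close> on the other; it would be the
  coboundary of a polynomial whose constant term is both \<open>1\<close> and \<open>0\<close>.\<close>

lemma Koszul_H1_edge_module_join:
  fixes G :: "'v ugraph"
  assumes G: "simple_graph G" and V: "verts G = A \<union> B" "A \<inter> B = {}" "A \<noteq> {}" "B \<noteq> {}"
    and join: "\<And>x y. x \<in> A \<Longrightarrow> y \<in> B \<Longrightarrow> {x, y} \<in> edges G"
  shows "\<not> Koszul_H1_vanishes (var ` verts G) (edge_module G :: (_, ('v, 'k::field) mpolynomial set) module)"
proof
  let ?R = "poly_ring (verts G) :: ('v, 'k) mpolynomial ring"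
  let ?M = "edge_module G :: (_, ('v, 'k) mpolynomial set) module"
  assume H1: "Koszul_H1_vanishes (var ` verts G) ?M"
  interpret R: cring ?R by (rule poly_ring_cring)
  interpret I: ideal "edge_ideal G" ?R by (rule edge_ideal_ideal[OF G])
  define c where "c p = (if p \<in> var ` A then p else 0)" for p :: "('v, 'k) mpolynomial"
  have cA: "c (var v) = var v" if "v \<in> A" for v
    using that by (simp add: c_def)
  have cB: "c (var v) = 0" if "v \<in> B" for v
    using that V(2) by (auto simp: c_def dest: injD[OF inj_var])
  have car: "var v \<in> carrier ?R" "c (var v) \<in> carrier ?R" if "v \<in> verts G" for v
    using that var_in_poly_ring[of v "verts G"] by (auto simp: c_def)
  have edge: "var v * var w \<in> (edge_ideal G :: ('v, 'k) mpolynomial set)" if "v \<in> A" "w \<in> B" for v w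
    using join[OF that] that V(1)
    by (auto simp: edge_ideal_eq[OF G] var_times_var_keys keys_add_nat intro!: bexI[of _ "{v, w}"])
  \<comment> \<open>On one side of the join the two products agree or are both 0; across the sides
    their difference is an edge monomial up to sign.\<close>
  have "var v * c (var w) - var w * c (var v) \<in> edge_ideal G" if "v \<in> verts G" "w \<in> verts G" for v w
  proof -
    have "- (var v * var w) \<in> (edge_ideal G :: ('v, 'k) mpolynomial set)" if "v \<in> A" "w \<in> B"
      using I.a_inv_closed[OF edge[OF that]] poly_ring_a_inv[OF I.Icarr[OF edge[OF that]]] by simp
    then show ?thesis
      using that edge[of v w] edge[of w v] I.zero_closed unfolding V(1)
      by (auto simp: cA cB mult.commute)
  qed
  moreover have "p * q \<in> carrier ?R" if "p \<in> carrier ?R" "q \<in> carrier ?R" for p q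
    using R.m_closed[OF that] by simp
  ultimately have co: "var v \<odot>\<^bsub>?M\<^esub> edge_class G (c (var w)) = var w \<odot>\<^bsub>?M\<^esub> edge_class G (c (var v))"
    if "v \<in> verts G" "w \<in> verts G" for v w
    using that car by (simp add: smult_edge_class[OF G] edge_class_eq_iff[OF G] del: poly_ring_simps)
  have "(\<lambda>s. edge_class G (c s)) \<in> var ` verts G \<rightarrow> carrier ?M"
    using car by (auto simp: carrier_edge_module simp del: poly_ring_simps)
  then have "\<exists>y\<in>carrier ?M. \<forall>s\<in>var ` verts G. s \<odot>\<^bsub>?M\<^esub> y = edge_class G (c s)"
    using co by (intro H1[unfolded Koszul_H1_vanishes_def, rule_format]) auto
  then obtain h where h: "h \<in> carrier ?R"
    "\<And>v. v \<in> verts G \<Longrightarrow> var v \<odot>\<^bsub>?M\<^esub> edge_class G h = edge_class G (c (var v))"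
    by (auto simp: carrier_edge_module simp del: poly_ring_simps)
  have coeff: "Poly_Mapping.lookup h 0 = Poly_Mapping.lookup (c (var v)) (Poly_Mapping.single v 1)"
    if v: "v \<in> verts G" for v
  proof -
    have "var v * h \<in> carrier ?R"
      using R.m_closed[OF car(1)[OF v] h(1)] by simp
    then have "var v * h - c (var v) \<in> edge_ideal G"
      using h(2)[OF v] car[OF v] h(1) by (simp add: smult_edge_class[OF G] edge_class_eq_iff[OF G] del: poly_ring_simps)
    then have all: "\<forall>t\<in>Poly_Mapping.keys (var v * h - c (var v)). \<exists>e\<in>edges G. e \<subseteq> Poly_Mapping.keys t"
      by (simp add: edge_ideal_eq[OF G])
    \<comment> \<open>The edge ideal has no linear monomials because an edge has two distinct ends.
      Hence the congruence modulo the ideal is an equality at the coefficient of the variable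
      \<open>v\<close>.\<close>
    have "\<exists>e\<in>edges G. e \<subseteq> {v}"
      if "Poly_Mapping.single v 1 \<in> Poly_Mapping.keys (var v * h - c (var v))"
      using bspec[OF all that] by simp
    moreover have "\<not> e \<subseteq> {v}" if e: "e \<in> edges G" for e
    proof -
      obtain x y where "e = {x, y}" "x \<noteq> y"
        using bspec[OF G[unfolded simple_graph_def, THEN conjunct2] e] by blast
      then show ?thesis by auto
    qed
    ultimately have "Poly_Mapping.single v 1 \<notin> Poly_Mapping.keys (var v * h - c (var v))"
      by blast
    then show ?thesis
      using lookup_var_mult[of v h] by (simp add: in_keys_iff lookup_minus)
  qed
  obtain v w where vw: "v \<in> A" "w \<in> B" using V by blast
  have "Poly_Mapping.lookup h 0 = 1"
    using coeff[of v] vw(1) V(1) unfolding cA[OF vw(1)] by (simp add: var_def)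
  moreover have "Poly_Mapping.lookup h 0 = 0"
    using coeff[of w] vw(2) V(1) unfolding cB[OF vw(2)] by simp
  ultimately show False by simp
qed

text \<open>For a join of nonempty parts, \<open>extend\<close> says that no vertex is adjacent to
  all others, that is, no facet of the independence complex is a single vertex.\<close>

lemma join_not_sequentially_CM:
  fixes G :: "'v ugraph"
  assumes G: "simple_graph G" and V: "verts G = A \<union> B" "A \<inter> B = {}" "A \<noteq> {}" "B \<noteq> {}"
    and join: "\<And>x y. x \<in> A \<Longrightarrow> y \<in> B \<Longrightarrow> {x, y} \<in> edges G"
    and extend: "\<And>F. independent_set G F \<Longrightarrow>
      \<exists>F'. F \<subseteq> F' \<and> independent_set G F' \<and> (\<exists>v\<in>F'. \<exists>w\<in>F'. v \<noteq> w)"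
  shows "\<not> sequentially_CM_graph TYPE('k::field) G"
proof
  assume "sequentially_CM_graph TYPE('k) G"
  then have scm: "sequentially_Cohen_Macaulay (poly_ring (verts G) :: ('v, 'k) mpolynomial ring)
      (Idl\<^bsub>poly_ring (verts G)\<^esub> (var ` verts G)) (edge_module_grading G) (edge_module G)"
    by (simp add: sequentially_CM_graph_def irrelevant_ideal_def)
  have vars: "var ` verts G \<subseteq> carrier (poly_ring (verts G) :: ('v, 'k) mpolynomial ring)"
    by (intro image_subsetI var_in_poly_ring)
  have "Koszul_H1_vanishes (var ` verts G) (edge_module G :: (_, ('v, 'k) mpolynomial set) module)"
  proof (rule module.Koszul_H1_vanishes_if_sequentially_Cohen_Macaulay[OF edge_module_module[OF G] vars scm])
    fix N :: "('v, 'k) mpolynomial set set"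
    assume N: "submodule N (poly_ring (verts G)) (edge_module G)" "N \<noteq> {\<zero>\<^bsub>edge_module G\<^esub>}"
    show "2 \<le> module_dim (poly_ring (verts G))
        (quot_module ((edge_module G)\<lparr>carrier := N\<rparr>) {\<zero>\<^bsub>edge_module G\<^esub>})"
      by (rule submodule_edge_module_dim_ge_2[OF G _ N]) (rule extend)
  qed
  moreover have "\<not> Koszul_H1_vanishes (var ` verts G) (edge_module G :: (_, ('v, 'k) mpolynomial set) module)"
    by (rule Koszul_H1_edge_module_join[OF G V]) (rule join)
  ultimately show False by blast
qed

theorem theorem6p6:
  fixes a b n :: nat
  assumes "a \<ge> 2" and "n \<ge> 1" and "b \<ge> 3"
  shows "\<not> sequentially_CM_graph TYPE('k::field) (edgeless_graph a \<nabla> copies n (B_graph b))"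
proof -
  let ?H = "copies n (B_graph b)"
  let ?G = "edgeless_graph a \<nabla> ?H"
  let ?A = "Inl ` {1..a} :: (nat + nat \<times> bvertex) set" and ?B = "Inr ` verts ?H"
  have indep_A: "independent_set ?G ?A"
    by (auto simp: independent_set_def join_graph_def edgeless_graph_def copies_def B_graph_def)
  have two_A: "\<exists>v\<in>?A. \<exists>w\<in>?A. v \<noteq> w"
    using assms(1) by (intro bexI[of _ "Inl 1"] bexI[of _ "Inl 2"]) auto
  \<comment> \<open>\<open>Xv i\<close> meets only \<open>Yv i\<close> among the \<open>Yv\<close>
    vertices of its copy, so \<open>Yv j\<close> with \<open>j\<close> different from
    \<open>i\<close> is a partner, and symmetrically. Staying in the same copy covers the case
    \<open>n = 1\<close>.\<close>
  have partner: "\<exists>v'. v' \<noteq> v \<and> independent_set ?G {Inr v, Inr v'}" if v: "v \<in> verts ?H" for v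
  proof -
    have ne: "\<exists>j. 1 \<le> j \<and> j \<le> b \<and> j \<noteq> i" for i
      using assms(3) by (intro exI[of _ "if i = 1 then 2 else 1"]) auto
    obtain k i where v': "k \<in> {1..n}" "1 \<le> i" "i \<le> b" "v = (k, Xv i) \<or> v = (k, Yv i)"
      using v by (auto simp: copies_def B_graph_def)
    obtain j where "1 \<le> j" "j \<le> b" "j \<noteq> i"
      using ne by blast
    with v' have "independent_set ?G {Inr (k, Xv i), Inr (k, Yv j)}"
      "independent_set ?G {Inr (k, Yv i), Inr (k, Xv j)}"
      by (auto simp: independent_set_def join_graph_def edgeless_graph_def copies_def B_graph_def)
    with v'(4) show ?thesis by blast
  qed
  have verts: "verts ?G = ?A \<union> ?B"
    by (auto simp: join_graph_def edgeless_graph_def)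
  show ?thesis
  proof (rule join_not_sequentially_CM[of _ ?A ?B])
    show "simple_graph ?G"
      by (intro simple_graph_join simple_graph_edgeless simple_graph_copies simple_graph_B)
    show "verts ?G = ?A \<union> ?B" by (rule verts)
    show "?A \<inter> ?B = {}" by auto
    \<comment> \<open>The bound \<open>n \<ge> 1\<close> enters here: with no copies the second part
      of the join would be empty.\<close>
    show "?A \<noteq> {}" "?B \<noteq> {}"
      using assms by (auto simp: copies_def B_graph_def)
    show "{x, y} \<in> edges ?G" if "x \<in> ?A" "y \<in> ?B" for x y
      using that by (auto simp: join_graph_def edgeless_graph_def)
    show "\<exists>F'. F \<subseteq> F' \<and> independent_set ?G F' \<and> (\<exists>v\<in>F'. \<exists>w\<in>F'. v \<noteq> w)"
      if F: "independent_set ?G F" for F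
    proof (cases "F \<subseteq> ?A")
      case True
      then show ?thesis using indep_A two_A by (intro exI[of _ ?A] conjI)
    next
      case False
      then obtain x where x: "x \<in> F" "x \<notin> ?A" by (auto simp: subset_iff simp del: image_iff)
      have "F \<subseteq> ?A \<union> ?B"
        using F by (simp only: independent_set_def verts)
      with x have "x \<in> ?B" by (meson UnE subsetD)
      with x obtain v where v: "Inr v \<in> F" "v \<in> verts ?H" by (elim imageE) simp
      show ?thesis
      \<comment> \<open>Only a singleton needs its partner; otherwise \<open>F\<close> already has a
        second vertex and extends to itself.\<close>
      proof (cases "F = {Inr v}")
        case True
        obtain v' where "v' \<noteq> v" "independent_set ?G {Inr v, Inr v'}"
          using partner[OF v(2)] by blast
        then show ?thesis
          using True by (intro exI[of _ "{Inr v, Inr v'}"]) auto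
      next
        case False
        then show ?thesis
          using F v by (intro exI[of _ F] conjI) auto
      qed
    qed
  qed
qed

end
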